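(* Let $\mathcal{C}$ be an $\omega$-category and $\alpha\in\{-,+\}$. For $n\ge0$ set $\mathcal{N}_n^\alpha(\mathcal{C})=\omega Cat(I^{n+1},\mathcal{C})^\alpha$ and, for $0\le i\le n$, let $\partial_i:\mathcal{N}_n^\alpha(\mathcal{C})\to\mathcal{N}_{n-1}^\alpha(\mathcal{C})$ (for $n\geq 1$) be the map $\partial_{i+1}^\alpha$ and let $\epsilon_i:\mathcal{N}_n^\alpha(\mathcal{C})\to\mathcal{N}_{n+1}^\alpha(\mathcal{C})$ be the map $\Gamma_{i+1}^\alpha$. Then $(\mathcal{N}_*^\alpha(\mathcal{C}),\partial_i,\epsilon_i)$ is a simplicial set. Its unnormalized chain complex $(\mathbb{Z}\mathcal{N}_*^\alpha(\mathcal{C}),\sum_i(-1)^i\partial_i)$ computes the corner homology of $\mathcal{C}$ up to a shift by one: its $n$-th homology group is $H_{n+1}^\alpha(\mathcal{C})$ for every $n\ge1$. Moreover $\mathcal{N}^\alpha$ induces a functor from the category $\omega Cat_1$ of $\omega$-categories and non $1$-contracting $\omega$-functors to the category of simplicial sets.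
   Context: An $\omega$-category is a set $A$ with maps $s_n=d_n^-$ and $t_n=d_n^+$ from $A$ to $A$ ($n\ge 0$) and partial binary operations $*_n$ ($n\ge 0$), where $x*_n y$ is defined exactly when $t_n x=s_n y$, such that for all $\alpha,\beta\in\{-,+\}$: (1) $d_m^\beta d_n^\alpha x=d_m^\beta x$ if $m<n$ and $d_m^\beta d_n^\alpha x=d_n^\alpha x$ if $m\ge n$; (2) $s_nx*_nx=x*_nt_nx=x$; (3) if $x*_ny$ is defined then $s_n(x*_ny)=s_nx$, $t_n(x*_ny)=t_ny$, and $d_m^\alpha(x*_ny)=d_m^\alpha x*_nd_m^\alpha y$ for $m\neq n$; (4) $(x*_ny)*_nz=x*_n(y*_nz)$ when both sides exist; (5) $(x*_ny)*_m(z*_nw)=(x*_mz)*_n(y*_mw)$ for $m\neq n$ when both sides make sense; (6) for every $x$ there is $n$ with $s_nx=t_nx=x$; the least such $n$ is the dimension $\dim(x)$. An $\omega$-functor preserves all $s_n,t_n,*_n$; $\omega Cat$ is the resulting category. An $\omega$-functor $f$ is non $1$-contracting if $f(x)$ is $1$-dimensional for every $1$-dimensional $x$. $\mathbb{Z}S$ is the free abelian group on $S$. The $\omega$-category $I^n$ of the $n$-cube: let $\Lambda^n$ be the set of words $k_1\dots k_n$ in the alphabet $\{-,0,+\}$ (faces of the $n$-cube), the dimension being the number of zeros. For $x\in\Lambda^n$ of dimension $i$ and $y\in\Lambda^i$, let $r_y(x)$ be obtained by replacing the $\ell$-th zero of $x$ by $y(\ell)$ for all $\ell$. Write $b_y(x)=r_y(x)$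 if $y(\ell)\ne0$ implies $y(\ell)=(-)^\ell$ (sign $-$ for $\ell$ odd, $+$ for $\ell$ even), and $e_y(x)=r_y(x)$ if $y(\ell)\neq0$ implies $y(\ell)=(-)^{\ell+1}$. For $X\subset\Lambda^n$ let $R(X)$ be the smallest subset containing $X$ and stable under all the operations $x\mapsto b_y(x)$, $x\mapsto e_y(x)$. $I^n$ is the unique $\omega$-category whose elements are subsets of $\Lambda^n$ of the form $R(X)$, including all $R(\{x\})$, $x\in\Lambda^n$; such that every element is a composite of elements $R(\{x\})$; for $x$ of dimension $p\ge1$, $s_{p-1}R(\{x\})=R(\{b_y(x):\dim y=p-1\})$ and $t_{p-1}R(\{x\})=R(\{e_y(x):\dim y=p-1\})$; and whenever $t_pR(X)=s_pR(Y)$, $R(X)*_pR(Y)=R(X\cup Y)$. It is freely generated by the faces of the $n$-cube. For $x\in\omega Cat(I^n,\mathcal{C})$ write $x(k_1\dots k_n)=x(R(\{k_1\dots k_n\}))$. Operations on the cubical singular nerve $\omega Cat(I^*,\mathcal{C})$: $\partial_i^\alpha(x)(k_1\dots k_{n-1})=x(k_1\dots k_{i-1}\,\alpha\,k_i\dots k_{n-1})$, $\epsilon_i(x)(k_1\dots k_{n+1})=x(k_1\dots\widehat{k_i}\dots k_{n+1})$, and, for $1\le i\le n$, $\Gamma_i^-(x)(k_1\dots k_{n+1})=x(k_1\dots\max(k_i,k_{i+1})\dots k_{n+1})$, $\Gamma_i^+(x)(k_1\dots k_{n+1})=x(k_1\dots\min(k_i,k_{i+1})\dots k_{n+1})$,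 with $-<0<+$. Degenerate means in the image of some $\epsilon_i$. Corner homologies: $\omega Cat(I^n,\mathcal{C})^\alpha$ is the set of non degenerate $x\in\omega Cat(I^n,\mathcal{C})$ all of whose iterated faces $\partial^\alpha_{i_1}\cdots\partial^\alpha_{i_p}(x)$ are non degenerate. With $\partial^\alpha=\sum_i(-1)^{i+1}\partial_i^\alpha$, $H_*^\alpha(\mathcal{C})=H_*(\mathbb{Z}\omega Cat(I^*,\mathcal{C})^\alpha,\partial^\alpha)$. *)

theory Defs
  imports "HOL-Algebra.Free_Abelian_Groups"
begin

section \<open>Omega-categories and omega-functors\<close>

datatype sign = Minus | Plus

text \<open>\<open>bd C Minus n\<close> is the \<open>n\<close>-source, \<open>bd C Plus n\<close> the \<open>n\<close>-target. The values of the
  operations outside \<open>cells C\<close>, and of \<open>comp C n x y\<close> for pairs that are not composable,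
  are irrelevant.\<close>

record 'a ocat =
  cells :: "'a set"
  bd :: "sign \<Rightarrow> nat \<Rightarrow> 'a \<Rightarrow> 'a"
  comp :: "nat \<Rightarrow> 'a \<Rightarrow> 'a \<Rightarrow> 'a"

definition composable :: "'a ocat \<Rightarrow> nat \<Rightarrow> 'a \<Rightarrow> 'a \<Rightarrow> bool" where
  "composable C n x y \<longleftrightarrow> x \<in> cells C \<and> y \<in> cells C \<and> bd C Plus n x = bd C Minus n y"

locale omega_category =
  fixes C :: "'a ocat"
  assumes bd_closed: "x \<in> cells C \<Longrightarrow> bd C \<alpha> n x \<in> cells C"
    and comp_closed: "composable C n x y \<Longrightarrow> comp C n x y \<in> cells C"
    and bd_bd_less: "x \<in> cells C \<Longrightarrow> m < n \<Longrightarrow> bd C \<beta> m (bd C \<alpha> n x) = bd C \<beta> m x"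
    and bd_bd_ge: "x \<in> cells C \<Longrightarrow> m \<ge> n \<Longrightarrow> bd C \<beta> m (bd C \<alpha> n x) = bd C \<alpha> n x"
    and unit_left: "x \<in> cells C \<Longrightarrow> comp C n (bd C Minus n x) x = x"
    and unit_right: "x \<in> cells C \<Longrightarrow> comp C n x (bd C Plus n x) = x"
    and src_comp: "composable C n x y \<Longrightarrow> bd C Minus n (comp C n x y) = bd C Minus n x"
    and tgt_comp: "composable C n x y \<Longrightarrow> bd C Plus n (comp C n x y) = bd C Plus n y"
    and bd_comp: "composable C n x y \<Longrightarrow> m \<noteq> n \<Longrightarrow>
          bd C \<alpha> m (comp C n x y) = comp C n (bd C \<alpha> m x) (bd C \<alpha> m y)"
    and assoc: "composable C n x y \<Longrightarrow> composable C n (comp C n x y) z \<Longrightarrow>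
          composable C n y z \<Longrightarrow> composable C n x (comp C n y z) \<Longrightarrow>
          comp C n (comp C n x y) z = comp C n x (comp C n y z)"
    and interchange: "m \<noteq> n \<Longrightarrow>
          composable C n x y \<Longrightarrow> composable C n z w \<Longrightarrow>
          composable C m (comp C n x y) (comp C n z w) \<Longrightarrow>
          composable C m x z \<Longrightarrow> composable C m y w \<Longrightarrow>
          composable C n (comp C m x z) (comp C m y w) \<Longrightarrow>
          comp C m (comp C n x y) (comp C n z w) = comp C n (comp C m x z) (comp C m y w)"
    and finite_dim: "x \<in> cells C \<Longrightarrow> \<exists>n. bd C Minus n x = x \<and> bd C Plus n x = x"

definition cell_dim :: "'a ocat \<Rightarrow> 'a \<Rightarrow> nat" where
  "cell_dim C x = (LEAST n. bd C Minus n x = x \<and> bd C Plus n x = x)"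

text \<open>Functors are extensional (\<open>undefined\<close> outside \<open>cells C\<close>), so that equality of HOL functions
  is equality of omega-functors.\<close>

definition omega_functors :: "'a ocat \<Rightarrow> 'b ocat \<Rightarrow> ('a \<Rightarrow> 'b) set" where
  "omega_functors C D = {f \<in> cells C \<rightarrow>\<^sub>E cells D.
     (\<forall>\<alpha> n. \<forall>x \<in> cells C. f (bd C \<alpha> n x) = bd D \<alpha> n (f x)) \<and>
     (\<forall>n x y. composable C n x y \<longrightarrow> f (comp C n x y) = comp D n (f x) (f y))}"

definition non_1_contracting :: "'a ocat \<Rightarrow> 'b ocat \<Rightarrow> ('a \<Rightarrow> 'b) \<Rightarrow> bool" where
  "non_1_contracting C D f \<longleftrightarrow> (\<forall>x \<in> cells C. cell_dim C x = 1 \<longrightarrow> cell_dim D (f x) = 1)"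

definition omega_cat1_hom :: "'a ocat \<Rightarrow> 'b ocat \<Rightarrow> ('a \<Rightarrow> 'b) set" where
  "omega_cat1_hom C D = {f \<in> omega_functors C D. non_1_contracting C D f}"

section \<open>The omega-category of the \<open>n\<close>-cube\<close>

text \<open>Faces of the \<open>n\<close>-cube are words of length \<open>n\<close>; the letters \<open>-\<close>, \<open>0\<close>, \<open>+\<close> are
  the integers \<open>-1\<close>, \<open>0\<close>, \<open>1\<close>.\<close>

fun letter :: "sign \<Rightarrow> int" where
  "letter Minus = -1"
| "letter Plus = 1"

definition faces :: "nat \<Rightarrow> int list set" where
  "faces n = {w. length w = n \<and> set w \<subseteq> {-1, 0, 1}}"

definition fdim :: "int list \<Rightarrow> nat" where
  "fdim w = count_list w 0"

text \<open>\<open>subst_zeros x y\<close> is \<open>r_y(x)\<close>: the successive zeros of \<open>x\<close> are replaced by the letters of \<open>y\<close>.\<close>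

fun subst_zeros :: "int list \<Rightarrow> int list \<Rightarrow> int list" where
  "subst_zeros [] y = []"
| "subst_zeros (k # x) [] = k # x"
| "subst_zeros (k # x) (l # y) =
     (if k = 0 then l # subst_zeros x y else k # subst_zeros x (l # y))"

text \<open>\<open>sign_word Minus y\<close> is the condition under which \<open>r_y(x)\<close> is called \<open>b_y(x)\<close>, and
  \<open>sign_word Plus y\<close> the one for \<open>e_y(x)\<close>. Positions of letters are counted from 1 in the
  mathematical definition and from 0 in \<open>y ! l\<close>.\<close>

definition sign_word :: "sign \<Rightarrow> int list \<Rightarrow> bool" where
  "sign_word \<alpha> y \<longleftrightarrow> (\<forall>l < length y. y ! l \<noteq> 0 \<longrightarrow>
     y ! l = (case \<alpha> of Minus \<Rightarrow> (-1) ^ (l + 1) | Plus \<Rightarrow> (-1) ^ (l + 2)))"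

inductive_set Rcl :: "int list set \<Rightarrow> int list set" for X :: "int list set" where
  base: "x \<in> X \<Longrightarrow> x \<in> Rcl X"
| step: "x \<in> Rcl X \<Longrightarrow> y \<in> faces (fdim x) \<Longrightarrow> sign_word \<alpha> y \<Longrightarrow> subst_zeros x y \<in> Rcl X"

inductive_set composites :: "'a ocat \<Rightarrow> 'a set \<Rightarrow> 'a set" for C :: "'a ocat" and S :: "'a set" where
  base: "x \<in> S \<Longrightarrow> x \<in> composites C S"
| comp: "x \<in> composites C S \<Longrightarrow> y \<in> composites C S \<Longrightarrow> composable C n x y \<Longrightarrow>
         comp C n x y \<in> composites C S"

text \<open>\<open>is_cube n I\<close> says that \<open>I\<close> is the omega-category of the \<open>n\<close>-cube. The conditions determine
  the set of cells and, on it, all operations of \<open>I\<close>; so a statement about any \<open>I\<close> with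
  \<open>is_cube n I\<close> is a statement about this one omega-category. Its existence is classical
  (Aitchison, Street, Al-Agl--Steiner, Crans) and is not proved here.\<close>

definition is_cube :: "nat \<Rightarrow> int list set ocat \<Rightarrow> bool" where
  "is_cube n I \<longleftrightarrow>
     omega_category I \<and>
     cells I \<subseteq> {Rcl X | X. X \<subseteq> faces n} \<and>
     (\<forall>x \<in> faces n. Rcl {x} \<in> cells I) \<and>
     cells I \<subseteq> composites I {Rcl {x} | x. x \<in> faces n} \<and>
     (\<forall>x \<in> faces n. \<forall>p \<alpha>. fdim x = Suc p \<longrightarrow>
        bd I \<alpha> p (Rcl {x}) =
          Rcl {subst_zeros x y | y. y \<in> faces (fdim x) \<and> fdim y = p \<and> sign_word \<alpha> y}) \<and>
     (\<forall>p X Y. X \<subseteq> faces n \<and> Y \<subseteq> faces n \<and> composable I p (Rcl X) (Rcl Y) \<longrightarrow>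
        comp I p (Rcl X) (Rcl Y) = Rcl (X \<union> Y))"

section \<open>The cubical singular nerve\<close>

text \<open>Throughout, \<open>I n\<close> is the omega-category of the \<open>n\<close>-cube.\<close>

type_synonym cubes = "nat \<Rightarrow> int list set ocat"
type_synonym 'c cube = "int list set \<Rightarrow> 'c"

definition scubes :: "cubes \<Rightarrow> 'c ocat \<Rightarrow> nat \<Rightarrow> 'c cube set" where
  "scubes I C n = omega_functors (I n) C"

text \<open>The singular \<open>m\<close>-cube whose value at each face \<open>k\<close> is the value of \<open>x\<close> at the face \<open>\<theta> k\<close>.\<close>

definition reindex :: "cubes \<Rightarrow> 'c ocat \<Rightarrow> nat \<Rightarrow> (int list \<Rightarrow> int list) \<Rightarrow> 'c cube \<Rightarrow> 'c cube" where
  "reindex I C m \<theta> x =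
     (THE z. z \<in> scubes I C m \<and> (\<forall>k \<in> faces m. z (Rcl {k}) = x (Rcl {\<theta> k})))"

text \<open>In the three operations below \<open>n\<close> is the dimension of the argument \<open>x\<close>.\<close>

definition cface :: "cubes \<Rightarrow> 'c ocat \<Rightarrow> sign \<Rightarrow> nat \<Rightarrow> nat \<Rightarrow> 'c cube \<Rightarrow> 'c cube" where
  "cface I C \<alpha> n i = reindex I C (n - 1) (\<lambda>k. take (i - 1) k @ letter \<alpha> # drop (i - 1) k)"

definition cdegen :: "cubes \<Rightarrow> 'c ocat \<Rightarrow> nat \<Rightarrow> nat \<Rightarrow> 'c cube \<Rightarrow> 'c cube" where
  "cdegen I C n i = reindex I C (n + 1) (\<lambda>k. take (i - 1) k @ drop i k)"

definition connection :: "cubes \<Rightarrow> 'c ocat \<Rightarrow> sign \<Rightarrow> nat \<Rightarrow> nat \<Rightarrow> 'c cube \<Rightarrow> 'c cube" where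
  "connection I C \<alpha> n i = reindex I C (n + 1)
     (\<lambda>k. take (i - 1) k @
          (case \<alpha> of Minus \<Rightarrow> max (k ! (i - 1)) (k ! i) | Plus \<Rightarrow> min (k ! (i - 1)) (k ! i)) #
          drop (i + 1) k)"

definition degenerate :: "cubes \<Rightarrow> 'c ocat \<Rightarrow> nat \<Rightarrow> 'c cube \<Rightarrow> bool" where
  "degenerate I C n x \<longleftrightarrow> (\<exists>i \<in> {1..n}. x \<in> cdegen I C (n - 1) i ` scubes I C (n - 1))"

text \<open>\<open>iterated_face I C \<alpha> n x m y\<close>: the \<open>m\<close>-cube \<open>y\<close> arises from the \<open>n\<close>-cube \<open>x\<close> by
  applying \<open>n - m \<ge> 0\<close> face operations of sign \<open>\<alpha>\<close>.\<close>

inductive iterated_face ::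
    "cubes \<Rightarrow> 'c ocat \<Rightarrow> sign \<Rightarrow> nat \<Rightarrow> 'c cube \<Rightarrow> nat \<Rightarrow> 'c cube \<Rightarrow> bool"
  for I :: cubes and C :: "'c ocat" and \<alpha> :: sign and n :: nat and x :: "'c cube" where
  refl: "iterated_face I C \<alpha> n x n x"
| step: "iterated_face I C \<alpha> n x (Suc m) y \<Longrightarrow> i \<in> {1..Suc m} \<Longrightarrow>
         iterated_face I C \<alpha> n x m (cface I C \<alpha> (Suc m) i y)"

definition corner_cubes :: "cubes \<Rightarrow> 'c ocat \<Rightarrow> sign \<Rightarrow> nat \<Rightarrow> 'c cube set" where
  "corner_cubes I C \<alpha> n =
     {x \<in> scubes I C n. \<forall>m y. iterated_face I C \<alpha> n x m y \<longrightarrow> \<not> degenerate I C m y}"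

section \<open>Homology of free chain complexes\<close>

text \<open>The homology of a complex of abelian groups \<open>K n\<close> with differentials \<open>d n\<close> from \<open>K n\<close> to
  \<open>K (n - 1)\<close> for \<open>n \<ge> 1\<close>; \<open>d 0\<close> is not used.\<close>

definition cycles :: "(nat \<Rightarrow> 'g monoid) \<Rightarrow> (nat \<Rightarrow> 'g \<Rightarrow> 'g) \<Rightarrow> nat \<Rightarrow> 'g set" where
  "cycles K d n = (if n = 0 then carrier (K 0) else kernel (K n) (K (n - 1)) (d n))"

definition chain_homology :: "(nat \<Rightarrow> 'g monoid) \<Rightarrow> (nat \<Rightarrow> 'g \<Rightarrow> 'g) \<Rightarrow> nat \<Rightarrow> 'g set monoid" where
  "chain_homology K d n =
     (K n)\<lparr>carrier := cycles K d n\<rparr> Mod (d (Suc n) ` carrier (K (Suc n)))"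

definition corner_boundary ::
    "cubes \<Rightarrow> 'c ocat \<Rightarrow> sign \<Rightarrow> nat \<Rightarrow> ('c cube \<Rightarrow>\<^sub>0 int) \<Rightarrow> ('c cube \<Rightarrow>\<^sub>0 int)" where
  "corner_boundary I C \<alpha> n =
     frag_extend (\<lambda>x. \<Sum>i = 1..n. frag_cmul ((-1) ^ (i + 1)) (frag_of (cface I C \<alpha> n i x)))"

definition corner_homology ::
    "cubes \<Rightarrow> 'c ocat \<Rightarrow> sign \<Rightarrow> nat \<Rightarrow> ('c cube \<Rightarrow>\<^sub>0 int) set monoid" where
  "corner_homology I C \<alpha> =
     chain_homology (\<lambda>n. free_Abelian_group (corner_cubes I C \<alpha> n)) (corner_boundary I C \<alpha>)"

section \<open>Simplicial sets\<close>

text \<open>\<open>sface X n i\<close> and \<open>sdegen X n i\<close> are the face and degeneracy maps out of degree \<open>n\<close>.\<close>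

record 'a sset =
  simplices :: "nat \<Rightarrow> 'a set"
  sface :: "nat \<Rightarrow> nat \<Rightarrow> 'a \<Rightarrow> 'a"
  sdegen :: "nat \<Rightarrow> nat \<Rightarrow> 'a \<Rightarrow> 'a"

locale simplicial_set =
  fixes X :: "'a sset"
  assumes face_closed: "x \<in> simplices X (Suc n) \<Longrightarrow> i \<le> Suc n \<Longrightarrow>
      sface X (Suc n) i x \<in> simplices X n"
    and degen_closed: "x \<in> simplices X n \<Longrightarrow> i \<le> n \<Longrightarrow> sdegen X n i x \<in> simplices X (Suc n)"
    and face_face: "x \<in> simplices X (Suc (Suc n)) \<Longrightarrow> i < j \<Longrightarrow> j \<le> Suc (Suc n) \<Longrightarrow>
      sface X (Suc n) i (sface X (Suc (Suc n)) j x) =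
      sface X (Suc n) (j - 1) (sface X (Suc (Suc n)) i x)"
    and degen_degen: "x \<in> simplices X n \<Longrightarrow> i \<le> j \<Longrightarrow> j \<le> n \<Longrightarrow>
      sdegen X (Suc n) i (sdegen X n j x) = sdegen X (Suc n) (j + 1) (sdegen X n i x)"
    and face_degen_less: "x \<in> simplices X (Suc n) \<Longrightarrow> i < j \<Longrightarrow> j \<le> Suc n \<Longrightarrow>
      sface X (Suc (Suc n)) i (sdegen X (Suc n) j x) = sdegen X n (j - 1) (sface X (Suc n) i x)"
    and face_degen_same: "x \<in> simplices X n \<Longrightarrow> j \<le> n \<Longrightarrow>
      sface X (Suc n) j (sdegen X n j x) = x"
    and face_degen_Suc: "x \<in> simplices X n \<Longrightarrow> j \<le> n \<Longrightarrow>
      sface X (Suc n) (j + 1) (sdegen X n j x) = x"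
    and face_degen_greater: "x \<in> simplices X (Suc n) \<Longrightarrow> j + 1 < i \<Longrightarrow> i \<le> Suc (Suc n) \<Longrightarrow>
      sface X (Suc (Suc n)) i (sdegen X (Suc n) j x) = sdegen X n j (sface X (Suc n) (i - 1) x)"

definition simplicial_map :: "'a sset \<Rightarrow> 'b sset \<Rightarrow> (nat \<Rightarrow> 'a \<Rightarrow> 'b) \<Rightarrow> bool" where
  "simplicial_map X Y \<phi> \<longleftrightarrow>
     (\<forall>n. \<forall>x \<in> simplices X n. \<phi> n x \<in> simplices Y n) \<and>
     (\<forall>n. \<forall>x \<in> simplices X (Suc n). \<forall>i \<le> Suc n.
        \<phi> n (sface X (Suc n) i x) = sface Y (Suc n) i (\<phi> (Suc n) x)) \<and>
     (\<forall>n. \<forall>x \<in> simplices X n. \<forall>i \<le> n.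
        \<phi> (Suc n) (sdegen X n i x) = sdegen Y n i (\<phi> n x))"

definition unnormalized_boundary :: "'a sset \<Rightarrow> nat \<Rightarrow> ('a \<Rightarrow>\<^sub>0 int) \<Rightarrow> ('a \<Rightarrow>\<^sub>0 int)" where
  "unnormalized_boundary X n =
     frag_extend (\<lambda>x. \<Sum>i = 0..n. frag_cmul ((-1) ^ i) (frag_of (sface X n i x)))"

definition unnormalized_homology :: "'a sset \<Rightarrow> nat \<Rightarrow> ('a \<Rightarrow>\<^sub>0 int) set monoid" where
  "unnormalized_homology X =
     chain_homology (\<lambda>n. free_Abelian_group (simplices X n)) (unnormalized_boundary X)"

section \<open>The corner nerve\<close>

definition corner_nerve :: "cubes \<Rightarrow> 'c ocat \<Rightarrow> sign \<Rightarrow> 'c cube sset" where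
  "corner_nerve I C \<alpha> =
     \<lparr>simplices = (\<lambda>n. corner_cubes I C \<alpha> (n + 1)),
      sface = (\<lambda>n i. cface I C \<alpha> (n + 1) (i + 1)),
      sdegen = (\<lambda>n i. connection I C \<alpha> (n + 1) (i + 1))\<rparr>"

text \<open>Postcomposition with an omega-functor, as a map on \<open>n\<close>-simplices.\<close>

definition corner_nerve_map :: "cubes \<Rightarrow> ('c \<Rightarrow> 'd) \<Rightarrow> nat \<Rightarrow> 'c cube \<Rightarrow> 'd cube" where
  "corner_nerve_map I f n x = compose (cells (I (n + 1))) f x"

end

theory Submission
  imports Defs
begin

text \<open>Faces, degeneracies and connections of singular cubes are induced by maps of words, and such
  a map \<open>\<theta>\<close> induces a functor \<open>S \<mapsto> \<theta> ` S\<close> between cubes as soon as it is monotone and, on each face,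
  either preserves the dimension and the codimension one sources and targets, or sends some
  codimension one face in the source, and some in the target, onto the image of the whole face.
  Functors on the cube being determined by their values on faces, the simplicial identities become
  identities between words. A connection \<open>\<Gamma>\<^sub>j\<^sup>\<alpha> x = \<epsilon>\<^sub>j z\<close> would force \<open>z = x\<close> by
  applying \<open>\<partial>\<^sub>j\<^sup>\<alpha>\<close> and then make \<open>x\<close> degenerate by applying the opposite face. The shifted chain
  complexes agree literally in positive degrees. Finally, a corner cube cannot become degenerate
  under a non \<open>1\<close>-contracting functor because its corner edges do not.\<close>

section \<open>Words\<close>

text \<open>The obstacle lies in what the characterization of the cube leaves open: it prescribes
  the boundary of R({x}) only in codimension one, and it says nothing about the boundaries of
  vertices or about the dimension of R({x}). Since a contracting map of words must turn boundaries
  into identities, one has to derive that R({x}) is its own boundary from the dimension of x on. The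
  derivation rests on an order: cells are sets of words closed under passing to subfaces,
  composition is union, and the 0-source and 0-target of a cell span a box around it. So the
  boundary of R({x}) in dimension dim x is a subcell of R({x}); if it missed x, it would equal both
  the codimension one source and the codimension one target, which share no facet. Boundaries of
  lower dimension are reached by globularity from those of codimension one, which are composites of
  smaller faces; this is why inductions on the dimension of a face also run through composites.
  Images commute with unions, so that composition causes no trouble once boundaries are
  respected.\<close>

lemma Nil_in_faces [simp]: "[] \<in> faces n \<longleftrightarrow> n = 0"
  by (auto simp: faces_def)

lemma Cons_in_faces [simp]: "k # x \<in> faces n \<longleftrightarrow> (\<exists>m. n = Suc m \<and> k \<in> {-1, 0, 1} \<and> x \<in> faces m)"
  by (auto simp: faces_def)

lemma faces_0: "faces 0 = {[]}"
  by (auto simp: faces_def)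

lemma faces_SucE:
  assumes "x \<in> faces (Suc n)"
  obtains k y where "x = k # y" "k \<in> {-1, 0, 1}" "y \<in> faces n"
  using assms by (cases x) auto

lemma length_faces: "x \<in> faces n \<Longrightarrow> length x = n"
  by (simp add: faces_def)

lemma fdim_Nil [simp]: "fdim [] = 0"
  and fdim_Cons [simp]: "fdim (k # x) = (if k = 0 then Suc (fdim x) else fdim x)"
  by (auto simp: fdim_def)

section \<open>Facets: the codimension one faces in the source or in the target\<close>

fun flip :: "sign \<Rightarrow> sign" where
  "flip Minus = Plus"
| "flip Plus = Minus"

lemma letter_nonzero [simp]: "letter \<alpha> \<noteq> 0"
  by (cases \<alpha>) auto

lemma letter_in: "letter \<alpha> = -1 \<or> letter \<alpha> = 1"
  by (cases \<alpha>) auto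

text \<open>The words \<open>b\<^sub>y(x)\<close> (\<open>\<alpha> = Minus\<close>) or \<open>e\<^sub>y(x)\<close> (\<open>\<alpha> = Plus\<close>) with \<open>y\<close> of dimension one less
  than \<open>x\<close>.\<close>

fun facets :: "sign \<Rightarrow> int list \<Rightarrow> int list set" where
  "facets \<alpha> [] = {}"
| "facets \<alpha> (k # x) =
     (if k = 0 then insert (letter \<alpha> # x) ((#) 0 ` facets (flip \<alpha>) x) else (#) k ` facets \<alpha> x)"

lemma facets_faces: "x \<in> faces n \<Longrightarrow> z \<in> facets \<alpha> x \<Longrightarrow> z \<in> faces n"
proof (induction x arbitrary: n z \<alpha>)
  case (Cons k x)
  then show ?case using letter_in[of \<alpha>] by (auto split: if_splits)
qed simp

lemma fdim_facets: "z \<in> facets \<alpha> x \<Longrightarrow> fdim x = Suc (fdim z)"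
  by (induction x arbitrary: z \<alpha>) (auto split: if_splits)

lemma facets_nonempty: "fdim x \<noteq> 0 \<Longrightarrow> facets \<alpha> x \<noteq> {}"
  by (induction x arbitrary: \<alpha>) (auto split: if_splits)

lemma facets_empty: "fdim x = 0 \<Longrightarrow> facets \<alpha> x = {}"
  by (induction x arbitrary: \<alpha>) (auto split: if_splits)

lemma facets_disjoint: "\<alpha> \<noteq> \<beta> \<Longrightarrow> facets \<alpha> x \<inter> facets \<beta> x = {}"
proof (induction x arbitrary: \<alpha> \<beta>)
  case (Cons k x)
  have "flip \<alpha> \<noteq> flip \<beta>" "letter \<alpha> \<noteq> letter \<beta>"
    using Cons.prems by (cases \<alpha>; cases \<beta>; simp)+
  moreover have "facets (flip \<alpha>) x \<inter> facets (flip \<beta>) x = {}" "facets \<alpha> x \<inter> facets \<beta> x = {}"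
    using Cons.IH Cons.prems calculation by blast+
  ultimately show ?case
    by (auto simp: disjoint_iff)
qed auto

text \<open>Moving every position by one exchanges the two alternating sign patterns; this is the
  origin of \<open>flip\<close> in the recursion for \<open>facets\<close>.\<close>

lemma sign_word_Cons:
  "sign_word \<alpha> (k # y) \<longleftrightarrow> (k \<noteq> 0 \<longrightarrow> k = letter \<alpha>) \<and> sign_word (flip \<alpha>) y"
  by (cases \<alpha>) (auto simp: sign_word_def less_Suc_eq_0_disj)

lemma fdim_le: "fdim y \<le> length y"
  by (induction y) auto

lemma sign_word_full: "fdim y = length y \<Longrightarrow> sign_word \<alpha> y"
proof (induction y arbitrary: \<alpha>)
  case (Cons k y)
  then show ?case using fdim_le[of y] by (auto simp: sign_word_Cons split: if_splits)
qed (auto simp: sign_word_def)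

lemma subst_zeros_full: "fdim y = length y \<Longrightarrow> subst_zeros x y = x"
proof (induction x y rule: subst_zeros.induct)
  case (3 k x l y)
  then show ?case using fdim_le[of y] by (auto split: if_splits)
qed auto

text \<open>A word y of length p + 1 and dimension p has exactly one nonzero letter. Either it is
  the first one, which fixes the first zero of x, or it sits further on, and the recursion continues
  behind that zero with the opposite sign.\<close>

lemma facets_eq:
  assumes "fdim x = Suc p"
  shows "{subst_zeros x y | y. y \<in> faces (fdim x) \<and> fdim y = p \<and> sign_word \<alpha> y} = facets \<alpha> x"
  using assms
proof (induction x arbitrary: p \<alpha>)
  case (Cons k x)
  show ?case
  proof (cases "k = 0")
    case False
    then have "fdim x = Suc p" using Cons.prems by simp
    have s: "subst_zeros (k # x) y = k # subst_zeros x y" if "y \<in> faces (Suc p)" for y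
      using that False by (cases y) auto
    then have "{subst_zeros (k # x) y | y. y \<in> faces (Suc p) \<and> fdim y = p \<and> sign_word \<alpha> y}
        = {k # subst_zeros x y | y. y \<in> faces (Suc p) \<and> fdim y = p \<and> sign_word \<alpha> y}"
      by (intro Collect_cong) metis
    also have "\<dots> = (#) k ` {subst_zeros x y | y. y \<in> faces (Suc p) \<and> fdim y = p \<and> sign_word \<alpha> y}"
      by blast
    also have "\<dots> = (#) k ` facets \<alpha> x"
      using Cons.IH[OF \<open>fdim x = Suc p\<close>, of \<alpha>] \<open>fdim x = Suc p\<close> by simp
    finally show ?thesis using False Cons.prems by simp
  next
    case True
    then have p: "fdim x = p" using Cons.prems by simp
    have *: "z \<in> facets \<alpha> (0 # x) \<longleftrightarrow>
        (\<exists>l y. (l = -1 \<or> l = 0 \<or> l = 1) \<and> y \<in> faces p \<and> fdim (l # y) = p \<and> (l \<noteq> 0 \<longrightarrow> l = letter \<alpha>)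
          \<and> sign_word (flip \<alpha>) y \<and> z = l # subst_zeros x y)" (is "?L \<longleftrightarrow> ?R") for z
    proof
      assume ?L
      then consider "z = letter \<alpha> # x" | w where "w \<in> facets (flip \<alpha>) x" "z = 0 # w" by auto
      then show ?R
      proof cases
        case 1
        \<comment> \<open>The word of zeros substitutes nothing, so the first zero of the face is
          the only one that gets fixed.\<close>
        have "replicate p 0 \<in> faces p" by (auto simp: faces_def)
        moreover have "fdim (replicate p 0) = p" by (induction p) auto
        ultimately show ?thesis using 1 letter_in[of \<alpha>] sign_word_full[of "replicate p 0"]
            subst_zeros_full[of "replicate p 0"]
          by (intro exI[of _ "letter \<alpha>"] exI[of _ "replicate p 0"]) auto
      next
        case 2
        then obtain q where q: "p = Suc q" using fdim_facets p by blast
        with Cons.IH[of q "flip \<alpha>"] p 2 obtain y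
          where "y \<in> faces p" "fdim y = q" "sign_word (flip \<alpha>) y" "w = subst_zeros x y"
          by auto
        then show ?thesis using 2 q by (intro exI[of _ 0] exI[of _ y]) auto
      qed
    next
      assume ?R
      then obtain l y where ly: "y \<in> faces p" "fdim (l # y) = p" "l \<noteq> 0 \<longrightarrow> l = letter \<alpha>"
          "sign_word (flip \<alpha>) y" "z = l # subst_zeros x y" by blast
      show ?L
      proof (cases "l = 0")
        case True
        then obtain q where q: "p = Suc q" "fdim y = q" using ly by (cases p) auto
        then have "subst_zeros x y \<in> facets (flip \<alpha>) x"
          using Cons.IH[of q "flip \<alpha>"] p ly by auto
        then show ?thesis using ly True by auto
      next
        case False
        then show ?thesis using ly subst_zeros_full[of y x] length_faces[of y p] by auto
      qed
    qed
    show ?thesis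
    proof (rule Set.set_eqI)
      fix z
      have "z \<in> {subst_zeros (k # x) y | y. y \<in> faces (fdim (k # x)) \<and> fdim y = p \<and> sign_word \<alpha> y}
        \<longleftrightarrow> (\<exists>y\<in>faces (Suc p). fdim y = p \<and> sign_word \<alpha> y \<and> z = subst_zeros (k # x) y)"
        using p True by (auto simp del: subst_zeros.simps)
      also have "\<dots> \<longleftrightarrow> (\<exists>l y. l # y \<in> faces (Suc p) \<and> fdim (l # y) = p
          \<and> sign_word \<alpha> (l # y) \<and> z = subst_zeros (k # x) (l # y))"
        by (metis faces_SucE)
      also have "\<dots> \<longleftrightarrow> z \<in> facets \<alpha> (0 # x)"
        unfolding * sign_word_Cons using True by (auto simp: conj_assoc)
      finally show "z \<in> {subst_zeros (k # x) y | y. y \<in> faces (fdim (k # x)) \<and> fdim y = p \<and> sign_word \<alpha> y}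
        \<longleftrightarrow> z \<in> facets \<alpha> (k # x)" using True by simp
    qed
  qed
qed auto

section \<open>The order of subfaces and the closure R\<close>

definition face_le :: "int list \<Rightarrow> int list \<Rightarrow> bool" where
  "face_le w x \<longleftrightarrow> list_all2 (\<lambda>a b. a = b \<or> b = 0 \<and> a \<in> {-1, 0, 1}) w x"

lemma face_le_Nil [simp]: "face_le w [] \<longleftrightarrow> w = []" "face_le [] x \<longleftrightarrow> x = []"
  by (simp_all add: face_le_def)

lemma face_le_Cons [simp]:
  "face_le (a # w) (b # x) \<longleftrightarrow> (a = b \<or> b = 0 \<and> a \<in> {-1, 0, 1}) \<and> face_le w x"
  by (simp add: face_le_def)

lemma face_le_Cons2:
  "face_le w (b # x) \<longleftrightarrow> (\<exists>a w'. w = a # w' \<and> (a = b \<or> b = 0 \<and> a \<in> {-1, 0, 1}) \<and> face_le w' x)"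
  by (cases w) auto

lemma face_le_refl [simp]: "face_le x x"
  by (induction x) auto

lemma face_le_trans: "face_le u w \<Longrightarrow> face_le w x \<Longrightarrow> face_le u x"
proof (induction x arbitrary: u w)
  case (Cons b x)
  then show ?case by (fastforce simp: face_le_Cons2)
qed auto

lemma face_le_faces: "face_le w x \<Longrightarrow> x \<in> faces n \<Longrightarrow> w \<in> faces n"
proof (induction x arbitrary: w n)
  case (Cons b x)
  then obtain a w' where w: "w = a # w'" "a = b \<or> a \<in> {-1, 0, 1}" "face_le w' x"
    by (auto simp: face_le_Cons2)
  obtain m where "n = Suc m" "b \<in> {-1, 0, 1}" "x \<in> faces m" using Cons.prems by auto
  with w Cons.IH[of w' m] show ?case by auto
qed simp

lemma face_le_fdim: "face_le w x \<Longrightarrow> fdim w \<le> fdim x"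
proof (induction x arbitrary: w)
  case (Cons b x)
  then obtain a w' where "w = a # w'" "a = b \<or> b = 0" "face_le w' x"
    by (auto simp: face_le_Cons2)
  with Cons.IH[of w'] show ?case by auto
qed auto

lemma face_le_fdim_eq: "face_le w x \<Longrightarrow> fdim w = fdim x \<Longrightarrow> w = x"
proof (induction x arbitrary: w)
  case (Cons b x)
  then obtain a w' where w: "w = a # w'" "face_le w' x" by (auto simp: face_le_Cons2)
  then show ?case using Cons face_le_fdim[of w' x] by (auto split: if_splits)
qed auto

lemma facets_le: "z \<in> facets \<alpha> x \<Longrightarrow> face_le z x"
proof (induction x arbitrary: z \<alpha>)
  case (Cons k x)
  then show ?case using letter_in[of \<alpha>] by (auto split: if_splits)
qed simp

text \<open>At the first place where the words differ, x has a zero; giving it the letter of w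
  yields the facet. Its sign depends on the parity of the number of zeros before that place, hence
  the existential \<alpha>.\<close>

lemma face_le_neqE:
  assumes "face_le w x" "w \<noteq> x"
  obtains \<alpha> z where "z \<in> facets \<alpha> x" "face_le w z"
proof -
  have "\<exists>\<alpha>. \<exists>z\<in>facets \<alpha> x. face_le w z" using assms
  proof (induction x arbitrary: w)
    case (Cons b x)
    then obtain a w' where w: "w = a # w'" "a = b \<or> b = 0 \<and> a \<in> {-1, 0, 1}" "face_le w' x"
      by (auto simp: face_le_Cons2)
    show ?case
    proof (cases "a = b")
      case True
      then obtain \<alpha> z where z: "z \<in> facets \<alpha> x" "face_le w' z" using Cons.IH[of w'] Cons.prems w by auto
      have "b # z \<in> facets (if b = 0 then flip \<alpha> else \<alpha>) (b # x)"
        using z by (cases \<alpha>) auto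
      moreover have "face_le w (b # z)" using z w True by simp
      ultimately show ?thesis by blast
    next
      case False
      then have b: "b = 0" "a = -1 \<or> a = 1" using w by auto
      then obtain \<alpha> where "a = letter \<alpha>" by (metis letter.simps)
      then have "a # x \<in> facets \<alpha> (b # x)" "face_le w (a # x)" using b w by auto
      then show ?thesis by blast
    qed
  qed auto
  then show thesis using that by blast
qed

lemma subst_zeros_le: "y \<in> faces n \<Longrightarrow> face_le (subst_zeros x y) x"
  by (induction x y arbitrary: n rule: subst_zeros.induct) auto

text \<open>The closure uses only alternating substitutions, yet it reaches every subface: a proper
  subface lies in a facet of one of the two signs, and each such facet is one admissible
  substitution away.\<close>

lemma Rcl_faces:
  assumes "X \<subseteq> faces n" shows "Rcl X = {w. \<exists>x\<in>X. face_le w x}"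
proof (intro Set.set_eqI iffI)
  fix w assume "w \<in> Rcl X"
  then show "w \<in> {w. \<exists>x\<in>X. face_le w x}"
    by induction (auto intro: face_le_trans subst_zeros_le face_le_refl)
next
  fix w assume "w \<in> {w. \<exists>x\<in>X. face_le w x}"
  then obtain x where x: "x \<in> X" "face_le w x" by blast
  have "w \<in> Rcl X" if "face_le w z" "z \<in> Rcl X" for z
    using that
  proof (induction "fdim z" arbitrary: z rule: less_induct)
    case less
    show ?case
    proof (cases "w = z")
      case False
      then obtain \<alpha> z' where z': "z' \<in> facets \<alpha> z" "face_le w z'"
        using less face_le_neqE by blast
      then have "fdim z = Suc (fdim z')" by (simp add: fdim_facets)
      with z' obtain y where "y \<in> faces (fdim z)" "sign_word \<alpha> y" "z' = subst_zeros z y"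
        using facets_eq[of z "fdim z'" \<alpha>] by blast
      then have "z' \<in> Rcl X"
        using Rcl.step[OF \<open>z \<in> Rcl X\<close>] by blast
      then show ?thesis using less z' \<open>fdim z = _\<close> by auto
    qed (use less in simp)
  qed
  then show "w \<in> Rcl X" using x Rcl.base by blast
qed

lemma Rcl_singleton: "x \<in> faces n \<Longrightarrow> Rcl {x} = {w. face_le w x}"
  using Rcl_faces[of "{x}" n] by auto

lemma Rcl_UN:
  assumes "X \<subseteq> faces n" shows "Rcl X = (\<Union>x\<in>X. Rcl {x})"
proof -
  have "Rcl {x} = {w. face_le w x}" if "x \<in> X" for x
    using Rcl_singleton[of x n] that assms by auto
  then show ?thesis using Rcl_faces[OF assms] by auto
qed

lemma Rcl_Un: "X \<subseteq> faces n \<Longrightarrow> Y \<subseteq> faces n \<Longrightarrow> Rcl (X \<union> Y) = Rcl X \<union> Rcl Y"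
  using Rcl_faces[of "X \<union> Y" n] Rcl_faces[of X n] Rcl_faces[of Y n] by auto

lemma Rcl_vertex:
  assumes "x \<in> faces n" "fdim x = 0" shows "Rcl {x} = {x}"
  using assms face_le_fdim face_le_fdim_eq by (fastforce simp: Rcl_singleton)

text \<open>The vertex of x with all free coordinates at the same end. It turns out to be the
  0-source, respectively the 0-target, of R({x}); see \<open>bd_0_Rcl\<close>.\<close>

fun endpoint :: "sign \<Rightarrow> int list \<Rightarrow> int list" where
  "endpoint \<alpha> [] = []"
| "endpoint \<alpha> (k # x) = (if k = 0 then letter \<alpha> else k) # endpoint \<alpha> x"

lemma endpoint_le: "face_le (endpoint \<alpha> x) x"
proof (induction x)
  case (Cons k x)
  then show ?case using letter_in[of \<alpha>] by auto
qed simp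

text \<open>Fixing the first zero at \<open>letter \<alpha>\<close> gives a facet of sign \<alpha>
  and leaves the later zeros free to go to the same end.\<close>

lemma endpoint_facets: "fdim x \<noteq> 0 \<Longrightarrow> \<exists>z\<in>facets \<alpha> x. face_le (endpoint \<alpha> x) z"
proof (induction x)
  case (Cons k x)
  then show ?case using endpoint_le[of \<alpha> x] by auto
qed simp

section \<open>Cells of the cube\<close>

context omega_category
begin

lemma composableD:
  assumes "composable C n x y"
  shows "x \<in> cells C" "y \<in> cells C" "bd C Plus n x = bd C Minus n y"
  using assms by (auto simp: composable_def)

text \<open>The axiom on boundaries of composites gives only the equation, not that its right-hand
  side is defined. Below n the two boundaries coincide, and above n they keep their n-source and
  n-target.\<close>

lemma composable_bd:
  assumes "composable C n x y" "m \<noteq> n"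
  shows "composable C n (bd C \<alpha> m x) (bd C \<alpha> m y)"
proof (cases "m < n")
  case True
  have "bd C \<alpha> m x = bd C \<alpha> m (bd C Plus n x)" "bd C \<alpha> m y = bd C \<alpha> m (bd C Minus n y)"
    using bd_bd_less[OF composableD(1)[OF assms(1)] True] bd_bd_less[OF composableD(2)[OF assms(1)] True]
    by auto
  then have "bd C \<alpha> m x = bd C \<alpha> m y" using composableD[OF assms(1)] by simp
  then show ?thesis
    using composableD[OF assms(1)] True bd_closed bd_bd_ge by (auto simp: composable_def)
next
  case False
  then show ?thesis
    using composableD[OF assms(1)] assms(2) bd_closed bd_bd_less by (auto simp: composable_def)
qed

text \<open>Both factors have the boundaries of their common n-boundary, and the composite of such a
  cell with itself along n is that cell, by the unit law.\<close>

lemma bd_comp_less: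
  assumes "composable C n x y" "m < n"
  shows "bd C \<alpha> m x = bd C \<alpha> m y" "bd C \<alpha> m (comp C n x y) = bd C \<alpha> m x"
proof -
  have "bd C \<alpha> m x = bd C \<alpha> m (bd C Plus n x)" "bd C \<alpha> m y = bd C \<alpha> m (bd C Minus n y)"
    using bd_bd_less[OF composableD(1)[OF assms(1)] assms(2)]
      bd_bd_less[OF composableD(2)[OF assms(1)] assms(2)] by auto
  then show *: "bd C \<alpha> m x = bd C \<alpha> m y" using composableD[OF assms(1)] by simp
  have "bd C \<alpha> m (comp C n x y) = comp C n (bd C \<alpha> m x) (bd C \<alpha> m x)"
    using bd_comp[OF assms(1), of m \<alpha>] assms(2) * by simp
  also have "\<dots> = bd C \<alpha> m x"
    using unit_left[of "bd C \<alpha> m x" n] bd_closed[of x \<alpha> m] bd_bd_ge[of x m n Minus \<alpha>]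
      composableD[OF assms(1)] assms(2) by simp
  finally show "bd C \<alpha> m (comp C n x y) = bd C \<alpha> m x" .
qed

definition dim_le :: "nat \<Rightarrow> 'a \<Rightarrow> bool" where
  "dim_le p x \<longleftrightarrow> (\<forall>\<alpha>. bd C \<alpha> p x = x)"

lemma dim_le_bd: "x \<in> cells C \<Longrightarrow> dim_le p (bd C \<alpha> p x)"
  by (simp add: dim_le_def bd_bd_ge)

lemma dim_le_mono:
  assumes "x \<in> cells C" "dim_le p x" "p \<le> q"
  shows "dim_le q x"
  unfolding dim_le_def using assms bd_bd_ge[of x p q _ Plus] by (metis dim_le_def)

text \<open>For n = p both factors are their own p-boundaries, so being composable makes them equal
  and the composite trivial; otherwise boundaries act factor by factor.\<close>

lemma dim_le_comp:
  assumes "composable C n x y" "dim_le p x" "dim_le p y"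
  shows "dim_le p (comp C n x y)"
proof (cases "n = p")
  case True
  have "x = y" using assms composableD(3)[OF assms(1)] True by (simp add: dim_le_def)
  moreover have "comp C n x x = x"
    using unit_left[of x n] assms composableD[OF assms(1)] True by (simp add: dim_le_def)
  ultimately show ?thesis using assms by simp
next
  case False
  then show ?thesis using assms bd_comp[OF assms(1), of p] by (simp add: dim_le_def)
qed

end

section \<open>Cells of a cube as sets of words, their ends and their dimensions\<close>

locale cube_category =
  fixes n :: nat and I :: "int list set ocat"
  assumes is_cube: "is_cube n I"

lemma is_cubeD:
  assumes "is_cube n I"
  shows "omega_category I" "cells I \<subseteq> {Rcl X | X. X \<subseteq> faces n}"
    "x \<in> faces n \<Longrightarrow> Rcl {x} \<in> cells I"
    "cells I \<subseteq> composites I {Rcl {x} | x. x \<in> faces n}"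
    "x \<in> faces n \<Longrightarrow> fdim x = Suc p \<Longrightarrow> bd I \<alpha> p (Rcl {x}) =
       Rcl {subst_zeros x y | y. y \<in> faces (fdim x) \<and> fdim y = p \<and> sign_word \<alpha> y}"
    "X \<subseteq> faces n \<Longrightarrow> Y \<subseteq> faces n \<Longrightarrow> composable I p (Rcl X) (Rcl Y) \<Longrightarrow>
       comp I p (Rcl X) (Rcl Y) = Rcl (X \<union> Y)"
proof -
  note D = iffD1[OF is_cube_def assms]
  show "omega_category I" using D by (rule conjunct1)
  note D = D[THEN conjunct2]
  show "cells I \<subseteq> {Rcl X | X. X \<subseteq> faces n}" using D by (rule conjunct1)
  note D = D[THEN conjunct2]
  show "Rcl {x} \<in> cells I" if "x \<in> faces n" using D[THEN conjunct1] that by (rule bspec)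
  note D = D[THEN conjunct2]
  show "cells I \<subseteq> composites I {Rcl {x} | x. x \<in> faces n}" using D by (rule conjunct1)
  note D = D[THEN conjunct2]
  show "bd I \<alpha> p (Rcl {x}) =
       Rcl {subst_zeros x y | y. y \<in> faces (fdim x) \<and> fdim y = p \<and> sign_word \<alpha> y}"
    if "x \<in> faces n" "fdim x = Suc p"
    using D[THEN conjunct1, rule_format, OF that] .
  show "comp I p (Rcl X) (Rcl Y) = Rcl (X \<union> Y)"
    if "X \<subseteq> faces n" "Y \<subseteq> faces n" "composable I p (Rcl X) (Rcl Y)"
    using D[THEN conjunct2, rule_format, OF conjI[OF that(1) conjI[OF that(2,3)]]] .
qed

sublocale cube_category \<subseteq> omega_category I
  using is_cube by (rule is_cubeD)

context cube_category
begin

lemma cell_Rcl: "S \<in> cells I \<Longrightarrow> \<exists>X. X \<subseteq> faces n \<and> S = Rcl X"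
  using is_cubeD(2)[OF is_cube] by blast

lemma cell_down: "S \<in> cells I \<Longrightarrow> x \<in> S \<Longrightarrow> face_le w x \<Longrightarrow> w \<in> S"
proof -
  assume "S \<in> cells I" "x \<in> S" "face_le w x"
  moreover then obtain X where "X \<subseteq> faces n" "S = Rcl X" using cell_Rcl by metis
  ultimately show "w \<in> S" using Rcl_faces[of X n] face_le_trans[of w x] by auto
qed

lemma Rcl_cell: "x \<in> faces n \<Longrightarrow> Rcl {x} \<in> cells I"
  using is_cubeD(3)[OF is_cube] by blast

lemma comp_eq: "composable I p S T \<Longrightarrow> comp I p S T = S \<union> T"
proof -
  assume c: "composable I p S T"
  then obtain X Y where "X \<subseteq> faces n" "Y \<subseteq> faces n" "S = Rcl X" "T = Rcl Y"
    using cell_Rcl composableD by metis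
  then show ?thesis using c is_cubeD(6)[OF is_cube, of X Y p] Rcl_Un[of X n Y] by simp
qed

lemma bd_Rcl: "x \<in> faces n \<Longrightarrow> fdim x = Suc p \<Longrightarrow> bd I \<alpha> p (Rcl {x}) = Rcl (facets \<alpha> x)"
  using is_cubeD(5)[OF is_cube, of x p \<alpha>] facets_eq[of x p \<alpha>] by simp

text \<open>Composition is union, so every generator occurring in a decomposition of S is a face in
  S. The premise \<open>x \<in> S\<close> in the generator case records this and lets an outer
  induction on dimension apply to those faces.\<close>

lemma cell_induct [consumes 1, case_names gen comp]:
  assumes "S \<in> cells I"
    and gen: "\<And>x. x \<in> S \<Longrightarrow> x \<in> faces n \<Longrightarrow> P (Rcl {x})"
    and comp: "\<And>p S T. composable I p S T \<Longrightarrow> P S \<Longrightarrow> P T \<Longrightarrow> P (S \<union> T)"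
  shows "P S"
proof -
  have *: "P S" if "S \<in> composites I {Rcl {x} | x. x \<in> faces n}"
    "\<And>x. x \<in> S \<Longrightarrow> x \<in> faces n \<Longrightarrow> P (Rcl {x})" for S
    using that
  proof induction
    case (base S)
    then obtain x where x: "S = Rcl {x}" "x \<in> faces n" by blast
    moreover have "x \<in> Rcl {x}" by (rule Rcl.base) simp
    ultimately show ?case using base(2)[of x] by simp
  next
    case (comp S T p)
    note eq = comp_eq[OF comp(3)]
    have "P S" by (rule comp(4)) (use comp(6) eq in simp)
    moreover have "P T" by (rule comp(5)) (use comp(6) eq in simp)
    ultimately show ?case using assms(3)[OF comp(3)] eq by simp
  qed
  show ?thesis using is_cubeD(4)[OF is_cube] assms(1) by (intro *[OF _ gen]) auto
qed

text \<open>Boundaries of vertices are not prescribed, but freeing the first coordinate of a vertex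
  gives an edge of which it is the 0-source or 0-target. The 0-cube has no edges; there the only
  cell must be its own boundary.\<close>

lemma dim_vertex:
  assumes "x \<in> faces n" "fdim x = 0"
  shows "dim_le 0 {x}"
proof (cases n)
  case 0
  have "S = {[]}" if "S \<in> cells I" for S
    using that
  proof (induction rule: cell_induct)
    case (gen x)
    then show ?case using 0 Rcl_vertex[of "[]" 0] by (simp add: faces_0)
  qed simp
  moreover have "{x} \<in> cells I" using Rcl_vertex Rcl_cell assms by metis
  ultimately show ?thesis using bd_closed unfolding dim_le_def by metis
next
  case (Suc m)
  then obtain c x' where x: "x = c # x'" "c \<in> {-1, 0, 1}" "x' \<in> faces m"
    using assms faces_SucE by blast
  then obtain \<alpha> where \<alpha>: "c = letter \<alpha>"
    using assms by (auto split: if_splits) (metis letter.simps)+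
  have x'0: "fdim x' = 0" "0 # x' \<in> faces n" using x assms Suc by (auto split: if_splits)
  then have "bd I \<alpha> 0 (Rcl {0 # x'}) = Rcl {x}"
    using bd_Rcl[of "0 # x'" 0 \<alpha>] x \<alpha> facets_empty by simp
  then show ?thesis
    using dim_le_bd[OF Rcl_cell[OF x'0(2)], of 0 \<alpha>] Rcl_vertex assms by metis
qed

text \<open>A cell is contained in the box spanned by its \<open>0\<close>-source and its \<open>0\<close>-target. This is what
  forces \<open>R({x})\<close> to have the dimension of \<open>x\<close>, which is not among the defining conditions.\<close>

definition extremal :: "sign \<Rightarrow> int list \<Rightarrow> int list set \<Rightarrow> bool" where
  "extremal \<alpha> v S \<longleftrightarrow> v \<in> S \<and>
     (\<forall>w\<in>S. list_all2 (\<lambda>a b. letter \<alpha> * b \<le> letter \<alpha> * a) v w)"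

lemma list_all2_le_trans:
  assumes "list_all2 (\<lambda>a b. (c :: int) * b \<le> c * a) u v" "list_all2 (\<lambda>a b. c * b \<le> c * a) v w"
  shows "list_all2 (\<lambda>a b. c * b \<le> c * a) u w"
  using assms(1,2) by (rule list_all2_trans[rotated]) simp

text \<open>The vertex v is the far end of S and the near end of T, so u is compared with the words
  of T through v.\<close>

lemma extremal_Un_join:
  assumes "extremal \<alpha> u S" "extremal (flip \<alpha>) v S" "extremal \<alpha> v T"
  shows "extremal \<alpha> u (S \<union> T)"
proof -
  have "list_all2 (\<lambda>a b. letter \<alpha> * b \<le> letter \<alpha> * a) u w" if "w \<in> T" for w
  proof (rule list_all2_le_trans)
    show "list_all2 (\<lambda>a b. letter \<alpha> * b \<le> letter \<alpha> * a) u v"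
      using assms(1,2) by (simp add: extremal_def)
    show "list_all2 (\<lambda>a b. letter \<alpha> * b \<le> letter \<alpha> * a) v w"
      using assms(3) that by (simp add: extremal_def)
  qed
  then show ?thesis using assms by (auto simp: extremal_def)
qed

definition has_ends :: "int list set \<Rightarrow> bool" where
  "has_ends S \<longleftrightarrow> (\<forall>\<alpha>. \<exists>v. bd I \<alpha> 0 S = {v} \<and> extremal \<alpha> v S)"

text \<open>Composition along 0 glues the two cells at a common vertex; composition along a positive
  dimension leaves the 0-boundaries of both factors equal.\<close>

lemma has_ends_comp:
  assumes c: "composable I p S T" and "has_ends S" "has_ends T"
  shows "has_ends (S \<union> T)"
proof -
  obtain s t where s: "\<And>\<alpha>. bd I \<alpha> 0 S = {s \<alpha>}" "\<And>\<alpha>. extremal \<alpha> (s \<alpha>) S"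
    and t: "\<And>\<alpha>. bd I \<alpha> 0 T = {t \<alpha>}" "\<And>\<alpha>. extremal \<alpha> (t \<alpha>) T"
    using assms(2,3) unfolding has_ends_def by metis
  show ?thesis
  proof (cases "p = 0")
    case True
    then have eq: "s Plus = t Minus" using composableD(3)[OF c] s(1) t(1) by simp
    have "bd I Minus 0 (S \<union> T) = {s Minus}" "bd I Plus 0 (S \<union> T) = {t Plus}"
      using src_comp[OF c] tgt_comp[OF c] comp_eq[OF c] s(1) t(1) True by simp_all
    moreover have "extremal Minus (s Minus) (S \<union> T)"
      using extremal_Un_join[of Minus "s Minus" S "s Plus" T] s(2)[of Minus] s(2)[of Plus]
        t(2)[of Minus] eq by simp
    moreover have "extremal Plus (t Plus) (S \<union> T)"
      \<comment> \<open>Seen from the targets the order is reversed: T comes first and S is joined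
        to it.\<close>
      using extremal_Un_join[of Plus "t Plus" T "t Minus" S] s(2)[of Plus] t(2)[of Minus]
        t(2)[of Plus] eq by (simp add: Un_commute)
    ultimately have "\<exists>v. bd I \<alpha> 0 (S \<union> T) = {v} \<and> extremal \<alpha> v (S \<union> T)" for \<alpha>
      by (cases \<alpha>) auto
    then show ?thesis unfolding has_ends_def by blast
  next
    case False
    have "bd I \<alpha> 0 (S \<union> T) = {s \<alpha>}" "extremal \<alpha> (s \<alpha>) (S \<union> T)" for \<alpha>
    proof -
      have b: "bd I \<alpha> 0 S = bd I \<alpha> 0 T" "bd I \<alpha> 0 (S \<union> T) = bd I \<alpha> 0 S"
        using bd_comp_less[OF c, of 0 \<alpha>] comp_eq[OF c] False by simp_all
      then show "bd I \<alpha> 0 (S \<union> T) = {s \<alpha>}" using s(1) by simp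
      have "s \<alpha> = t \<alpha>" using b s(1) t(1) by simp
      then show "extremal \<alpha> (s \<alpha>) (S \<union> T)" using s(2)[of \<alpha>] t(2)[of \<alpha>] by (auto simp: extremal_def)
    qed
    then show ?thesis unfolding has_ends_def by blast
  qed
qed

lemma extremal_endpoint:
  assumes "x \<in> faces n"
  shows "extremal \<alpha> (endpoint \<alpha> x) (Rcl {x})"
proof -
  have "list_all2 (\<lambda>a b. letter \<alpha> * b \<le> letter \<alpha> * a) (endpoint \<alpha> x) w" if "face_le w x" for w
    using that
  proof (induction x arbitrary: w)
    case (Cons b x)
    then show ?case by (cases \<alpha>) (auto simp: face_le_Cons2)
  qed simp
  then show ?thesis using assms endpoint_le by (auto simp: extremal_def Rcl_singleton)
qed

lemma extremal_unique: "extremal \<alpha> u S \<Longrightarrow> extremal \<alpha> v S \<Longrightarrow> u = v"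
proof -
  have "u = v" if "list_all2 (\<lambda>a b. letter \<alpha> * b \<le> letter \<alpha> * a) u v"
    "list_all2 (\<lambda>a b. letter \<alpha> * b \<le> letter \<alpha> * a) v u" for u v
    by (rule list_all2_antisym[OF _ that]) (cases \<alpha>; simp)
  then show "extremal \<alpha> u S \<Longrightarrow> extremal \<alpha> v S \<Longrightarrow> u = v" by (simp add: extremal_def)
qed

text \<open>The second part drives the inductions on dimension: the codimension one boundary is a
  cell all of whose faces are smaller than x.\<close>

lemma facet_cell:
  assumes "x \<in> faces n" "fdim x \<noteq> 0"
  shows "Rcl (facets \<alpha> x) \<in> cells I" "\<And>w. w \<in> Rcl (facets \<alpha> x) \<Longrightarrow> face_le w x \<and> fdim w < fdim x"
proof -
  obtain p where p: "fdim x = Suc p" using assms(2) by (cases "fdim x") auto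
  then show "Rcl (facets \<alpha> x) \<in> cells I"
    using bd_Rcl[of x p \<alpha>] bd_closed[OF Rcl_cell[OF assms(1)], of \<alpha> p] assms(1) by simp
  fix w assume "w \<in> Rcl (facets \<alpha> x)"
  then obtain z where "z \<in> facets \<alpha> x" "face_le w z"
    using Rcl_faces[of "facets \<alpha> x" n] facets_faces[OF assms(1)] by blast
  then show "face_le w x \<and> fdim w < fdim x"
    using facets_le face_le_trans fdim_facets face_le_fdim le_imp_less_Suc by metis
qed

text \<open>The 0-boundary is already that of the codimension one boundary, which has ends by
  induction. The extreme vertex of x lies in that smaller cell and is extreme there too, so it is
  the end in question.\<close>

lemma has_ends_Rcl: "x \<in> faces n \<Longrightarrow> has_ends (Rcl {x})"
proof (induction "fdim x" arbitrary: x rule: less_induct)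
  case less
  show ?case
  proof (cases "fdim x")
    case 0
    then have "Rcl {x} = {x}" "endpoint \<alpha> x = x" for \<alpha>
      using less Rcl_vertex endpoint_le face_le_fdim_eq face_le_fdim by (metis le_zero_eq)+
    then show ?thesis
      using dim_vertex[of x] extremal_endpoint[of x] less 0 unfolding has_ends_def dim_le_def by metis
  next
    case (Suc p)
    have "bd I \<alpha> 0 (Rcl {x}) = {endpoint \<alpha> x}" for \<alpha>
    proof -
      let ?T = "Rcl (facets \<alpha> x)"
      have T: "?T \<in> cells I" "\<And>w. w \<in> ?T \<Longrightarrow> face_le w x \<and> fdim w < fdim x"
        using facet_cell[OF less.prems, where \<alpha> = \<alpha>] Suc by simp_all
      have "has_ends ?T" using T(1)
      proof (induction rule: cell_induct)
        case (gen w)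
        then show ?case using T(2)[of w] less.hyps by blast
      qed (rule has_ends_comp)
      then obtain v where v: "bd I \<alpha> 0 ?T = {v}" "extremal \<alpha> v ?T"
        unfolding has_ends_def by blast
      have sub: "?T \<subseteq> Rcl {x}" using T(2) less.prems by (auto simp: Rcl_singleton)
      have e: "extremal \<alpha> (endpoint \<alpha> x) (Rcl {x})" using extremal_endpoint less.prems by blast
      moreover have "endpoint \<alpha> x \<in> ?T"
        using endpoint_facets[of x \<alpha>] Suc Rcl_faces[of "facets \<alpha> x" n] facets_faces[OF less.prems]
        by fastforce
      ultimately have "extremal \<alpha> (endpoint \<alpha> x) ?T" using sub by (auto simp: extremal_def)
      then have "v = endpoint \<alpha> x" using v extremal_unique by blast
      \<comment> \<open>For an edge, p = 0 and the codimension one boundary is the 0-boundary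
        itself.\<close>
      moreover have "bd I \<alpha> 0 (Rcl {x}) = bd I \<alpha> 0 ?T"
        using bd_Rcl[OF less.prems Suc, of \<alpha>] bd_bd_less[OF Rcl_cell[OF less.prems], of 0 p \<alpha> \<alpha>]
          bd_bd_ge[OF Rcl_cell[OF less.prems], of 0 0 \<alpha> \<alpha>] by (cases p) auto
      ultimately show ?thesis using v by simp
    qed
    then show ?thesis using extremal_endpoint less.prems unfolding has_ends_def by blast
  qed
qed

lemma has_ends_cell: "S \<in> cells I \<Longrightarrow> has_ends S"
  by (induction rule: cell_induct) (auto intro: has_ends_Rcl has_ends_comp)

lemma bd_0_Rcl: "x \<in> faces n \<Longrightarrow> bd I \<alpha> 0 (Rcl {x}) = {endpoint \<alpha> x}"
  using has_ends_Rcl[of x] extremal_endpoint[of x \<alpha>] extremal_unique unfolding has_ends_def by metis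

text \<open>A word letterwise between the two endpoints of x agrees with x at its nonzero letters
  and is an arbitrary letter at its zeros, so it is a subface of x.\<close>

lemma cell_subset_Rcl:
  assumes "S \<in> cells I" "x \<in> faces n" "\<And>\<alpha>. bd I \<alpha> 0 S = bd I \<alpha> 0 (Rcl {x})"
  shows "S \<subseteq> Rcl {x}"
proof
  fix w assume w: "w \<in> S"
  have "extremal \<alpha> (endpoint \<alpha> x) S" for \<alpha>
    using has_ends_cell[OF assms(1)] assms(2,3) bd_0_Rcl[of x \<alpha>] unfolding has_ends_def
    by (metis singleton_inject)
  then have "list_all2 (\<lambda>a b. letter \<alpha> * b \<le> letter \<alpha> * a) (endpoint \<alpha> x) w" for \<alpha>
    using w by (auto simp: extremal_def)
  from this[of Minus] this[of Plus]
  have "list_all2 (\<lambda>a b. a \<le> b) (endpoint Minus x) w" "list_all2 (\<lambda>a b. b \<le> a) (endpoint Plus x) w"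
    by simp_all
  then have "face_le w x"
  proof (induction x arbitrary: w)
    case (Cons b x)
    then show ?case by (auto simp: list_all2_Cons1 split: if_splits)
  qed simp
  then show "w \<in> Rcl {x}" using assms(2) by (simp add: Rcl_singleton)
qed

lemma dim_le_Rcl: "x \<in> faces n \<Longrightarrow> dim_le (fdim x) (Rcl {x})"
proof (induction "fdim x" arbitrary: x rule: less_induct)
  case less
  note x = Rcl_cell[OF less.prems]
  show ?case
  proof (cases "fdim x")
    case 0
    then show ?thesis using dim_vertex[of x] Rcl_vertex[of x] less by simp
  next
    case (Suc p)
    have "bd I \<alpha> (Suc p) (Rcl {x}) = Rcl {x}" for \<alpha>
    proof -
      let ?u = "bd I \<alpha> (Suc p) (Rcl {x})"
      have u: "?u \<in> cells I" using bd_closed x by blast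
      \<comment> \<open>By globularity \<open>?u\<close> has the 0-boundaries of R({x}).\<close>
      have "?u \<subseteq> Rcl {x}" using cell_subset_Rcl[OF u less.prems] bd_bd_less[OF x] by simp
      moreover have "x \<in> ?u"
      proof (rule ccontr)
        assume "x \<notin> ?u"
        \<comment> \<open>All faces in \<open>?u\<close> are now proper subfaces of x, hence of
          dimension at most p, and composition does not raise dimension.\<close>
        have "dim_le p ?u" using u
        proof (induction rule: cell_induct)
          case (gen w)
          then have "face_le w x" "w \<noteq> x"
            using \<open>?u \<subseteq> Rcl {x}\<close> \<open>x \<notin> ?u\<close> less.prems by (auto simp: Rcl_singleton)
          then have "fdim w < fdim x" using face_le_fdim face_le_fdim_eq le_neq_implies_less by blast
          then show ?case
            using less.hyps[of w] gen Suc dim_le_mono[OF Rcl_cell, of w "fdim w" p] by simp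
        next
          case (comp q S T)
          then show ?case using dim_le_comp comp_eq by metis
        qed
        then have "?u = Rcl (facets \<beta> x)" for \<beta>
          using bd_bd_less[OF x, of p "Suc p" \<beta> \<alpha>] bd_Rcl[OF less.prems Suc, of \<beta>]
          by (simp add: dim_le_def)
        then have eq: "Rcl (facets Minus x) = Rcl (facets Plus x)" by metis
        obtain z where z: "z \<in> facets Minus x" using facets_nonempty[of x Minus] Suc by auto
        then have "z \<in> Rcl (facets Plus x)" using eq Rcl.base by blast
        then obtain z' where z': "z' \<in> facets Plus x" "face_le z z'"
          using Rcl_faces[of "facets Plus x" n] facets_faces[OF less.prems] by blast
        \<comment> \<open>Both words are facets of x and so have the same dimension, where inclusion
          of faces is equality.\<close>
        then have "z = z'" using face_le_fdim_eq fdim_facets z by (metis Suc_inject)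
        then show False using facets_disjoint[of Minus Plus x] z z' by auto
      qed
      ultimately show ?thesis
        using cell_down[OF u] less.prems by (auto simp: Rcl_singleton)
    qed
    then show ?thesis using Suc by (simp add: dim_le_def)
  qed
qed

end

section \<open>Maps of words inducing functors between cubes\<close>

definition cubical_map :: "nat \<Rightarrow> nat \<Rightarrow> (int list \<Rightarrow> int list) \<Rightarrow> bool" where
  "cubical_map m n \<theta> \<longleftrightarrow> (\<forall>x\<in>faces m. \<theta> x \<in> faces n \<and>
     (\<forall>w. face_le w x \<longrightarrow> face_le (\<theta> w) (\<theta> x)) \<and>
     (fdim (\<theta> x) = fdim x \<and> (\<forall>\<alpha>. facets \<alpha> (\<theta> x) = \<theta> ` facets \<alpha> x) \<or>
      fdim (\<theta> x) < fdim x \<and> (\<forall>\<alpha>. \<theta> x \<in> \<theta> ` facets \<alpha> x)))"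

lemma cubical_mapI:
  assumes "\<And>x. x \<in> faces m \<Longrightarrow> \<theta> x \<in> faces n"
    and "\<And>w x. x \<in> faces m \<Longrightarrow> face_le w x \<Longrightarrow> face_le (\<theta> w) (\<theta> x)"
    and "\<And>x. x \<in> faces m \<Longrightarrow> fdim (\<theta> x) = fdim x \<and> (\<forall>\<alpha>. facets \<alpha> (\<theta> x) = \<theta> ` facets \<alpha> x) \<or>
      fdim (\<theta> x) < fdim x \<and> (\<forall>\<alpha>. \<theta> x \<in> \<theta> ` facets \<alpha> x)"
  shows "cubical_map m n \<theta>"
  using assms unfolding cubical_map_def by blast

lemma cubical_mapD:
  assumes "cubical_map m n \<theta>" "x \<in> faces m"
  shows "\<theta> x \<in> faces n" "face_le w x \<Longrightarrow> face_le (\<theta> w) (\<theta> x)"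
    "fdim (\<theta> x) = fdim x \<and> (\<forall>\<alpha>. facets \<alpha> (\<theta> x) = \<theta> ` facets \<alpha> x) \<or>
      fdim (\<theta> x) < fdim x \<and> (\<forall>\<alpha>. \<theta> x \<in> \<theta> ` facets \<alpha> x)"
  using assms unfolding cubical_map_def by blast+

text \<open>An untouched first coordinate changes nothing, which reduces the word operations to
  position 0. Facets behind a leading zero have the opposite sign, so the condition on \<theta> is
  needed for both signs at once.\<close>

lemma cubical_map_lift:
  assumes \<theta>: "cubical_map m n \<theta>" and eq: "\<And>k x. x \<in> faces m \<Longrightarrow> \<theta>' (k # x) = k # \<theta> x"
  shows "cubical_map (Suc m) (Suc n) \<theta>'"
proof (rule cubical_mapI)
  fix x assume x: "x \<in> faces (Suc m)"
  then obtain k y where y: "x = k # y" "k \<in> {-1, 0, 1}" "y \<in> faces m" by (rule faces_SucE)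
  note D = cubical_mapD[OF \<theta> y(3)]
  show "\<theta>' x \<in> faces (Suc n)" using y eq D(1) by simp
  show "face_le (\<theta>' w) (\<theta>' x)" if "face_le w x" for w
  proof -
    obtain a w' where w: "w = a # w'" "a = k \<or> k = 0 \<and> a \<in> {-1, 0, 1}" "face_le w' y"
      using \<open>face_le w x\<close> y by (auto simp: face_le_Cons2)
    then have "w' \<in> faces m" using y face_le_faces by blast
    then show ?thesis using w y eq D(2) by simp
  qed
  have img: "\<theta>' ` ((#) c ` facets \<alpha> y) = (#) c ` \<theta> ` facets \<alpha> y" for c \<alpha>
    using eq facets_faces[OF y(3)] by (auto simp: image_image intro!: image_cong)
  from D(3) show "fdim (\<theta>' x) = fdim x \<and> (\<forall>\<alpha>. facets \<alpha> (\<theta>' x) = \<theta>' ` facets \<alpha> x) \<or>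
      fdim (\<theta>' x) < fdim x \<and> (\<forall>\<alpha>. \<theta>' x \<in> \<theta>' ` facets \<alpha> x)"
  proof (elim disjE conjE)
    assume *: "fdim (\<theta> y) = fdim y" "\<forall>\<alpha>. facets \<alpha> (\<theta> y) = \<theta> ` facets \<alpha> y"
    have "facets \<alpha> (\<theta>' x) = \<theta>' ` facets \<alpha> x" for \<alpha>
      using * y eq img by simp
    then show ?thesis using * y eq by simp
  next
    assume *: "fdim (\<theta> y) < fdim y" "\<forall>\<alpha>. \<theta> y \<in> \<theta> ` facets \<alpha> y"
    have "\<theta>' x \<in> \<theta>' ` ((#) k ` facets \<beta> y)" for \<beta>
      unfolding img using * y eq by simp
    then have "\<theta>' x \<in> \<theta>' ` facets \<alpha> x" for \<alpha>
      using y by auto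
    then show ?thesis using * y eq by simp
  qed
qed

section \<open>The words maps behind faces, degeneracies and connections\<close>

definition insert_letter :: "nat \<Rightarrow> int \<Rightarrow> int list \<Rightarrow> int list" where
  "insert_letter j a x = take j x @ a # drop j x"

definition delete_letter :: "nat \<Rightarrow> int list \<Rightarrow> int list" where
  "delete_letter j x = take j x @ drop (Suc j) x"

definition merge_letters :: "(int \<Rightarrow> int \<Rightarrow> int) \<Rightarrow> nat \<Rightarrow> int list \<Rightarrow> int list" where
  "merge_letters f j x = take j x @ f (x ! j) (x ! Suc j) # drop (Suc (Suc j)) x"

fun join_letters :: "sign \<Rightarrow> int \<Rightarrow> int \<Rightarrow> int" where
  "join_letters Minus a b = max a b"
| "join_letters Plus a b = min a b"

lemma letter_max_min:
  "max (letter \<alpha>) 1 = 1" "max 1 (letter \<alpha>) = 1"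
  "max (letter \<alpha>) (-1) = letter \<alpha>" "max (-1) (letter \<alpha>) = letter \<alpha>"
  "min (letter \<alpha>) 1 = letter \<alpha>" "min 1 (letter \<alpha>) = letter \<alpha>"
  "min (letter \<alpha>) (-1) = -1" "min (-1) (letter \<alpha>) = -1"
  by (cases \<alpha>; simp)+

lemma letter_ops [simp]:
  "insert_letter 0 a x = a # x"
  "insert_letter (Suc j) a (k # x) = k # insert_letter j a x"
  "delete_letter 0 (k # x) = x"
  "delete_letter (Suc j) (k # x) = k # delete_letter j x"
  "merge_letters f 0 (k # l # x) = f k l # x"
  "merge_letters f (Suc j) (k # x) = k # merge_letters f j x"
  by (simp_all add: insert_letter_def delete_letter_def merge_letters_def)

lemma cubical_map_insert: "j \<le> m \<Longrightarrow> cubical_map m (Suc m) (insert_letter j (letter \<alpha>))"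
proof (induction j arbitrary: m)
  case 0
  show ?case
    by (rule cubical_mapI) (use letter_in[of \<alpha>] in auto)
next
  case (Suc j)
  then obtain m' where "m = Suc m'" "j \<le> m'" by (cases m) auto
  then show ?case using cubical_map_lift[OF Suc.IH[of m']] by simp
qed

lemma cubical_map_delete: "j \<le> m \<Longrightarrow> cubical_map (Suc m) m (delete_letter j)"
proof (induction j arbitrary: m)
  case 0
  show ?case
  proof (rule cubical_mapI)
    fix x assume "x \<in> faces (Suc m)"
    then obtain k y where y: "x = k # y" "k \<in> {-1, 0, 1}" "y \<in> faces m" by (rule faces_SucE)
    then show "delete_letter 0 x \<in> faces m" by simp
    show "face_le (delete_letter 0 w) (delete_letter 0 x)" if "face_le w x" for w
      using that y by (auto simp: face_le_Cons2)
    show "fdim (delete_letter 0 x) = fdim x \<and>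
        (\<forall>\<alpha>. facets \<alpha> (delete_letter 0 x) = delete_letter 0 ` facets \<alpha> x) \<or>
      fdim (delete_letter 0 x) < fdim x \<and> (\<forall>\<alpha>. delete_letter 0 x \<in> delete_letter 0 ` facets \<alpha> x)"
      using y by (simp add: image_image)
  qed
next
  case (Suc j)
  then obtain m' where "m = Suc m'" "j \<le> m'" by (cases m) auto
  then show ?case using cubical_map_lift[OF Suc.IH[of m']] by simp
qed

text \<open>For \<open>join_letters \<beta>\<close> the letter of sign \<beta> is neutral and the
  other sign absorbing. Next to a neutral letter a zero survives and the dimension is kept; next to
  an absorbing one it disappears, and both ends of that coordinate have the same image. Two zeros
  form a square contracted to an edge.\<close>

lemma cubical_map_merge: "j \<le> m \<Longrightarrow> cubical_map (Suc (Suc m)) (Suc m) (merge_letters (join_letters \<beta>) j)"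
proof (induction j arbitrary: m)
  case 0
  let ?\<theta> = "merge_letters (join_letters \<beta>) 0"
  show ?case
  proof (rule cubical_mapI)
    fix x assume "x \<in> faces (Suc (Suc m))"
    then obtain k l y where y: "x = k # l # y" "k \<in> {-1, 0, 1}" "l \<in> {-1, 0, 1}" "y \<in> faces m"
      by (metis faces_SucE)
    then show "?\<theta> x \<in> faces (Suc m)" by (cases \<beta>) auto
    show "face_le (?\<theta> w) (?\<theta> x)" if "face_le w x" for w
    proof -
      obtain a b w' where w: "w = a # b # w'" "a = k \<or> k = 0 \<and> a \<in> {-1, 0, 1}"
        "b = l \<or> l = 0 \<and> b \<in> {-1, 0, 1}" "face_le w' y"
        using \<open>face_le w x\<close> y(1) by (auto simp: face_le_Cons2)
      then show ?thesis using y(1-3) by (cases \<beta>) auto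
    qed
    show "fdim (?\<theta> x) = fdim x \<and> (\<forall>\<alpha>. facets \<alpha> (?\<theta> x) = ?\<theta> ` facets \<alpha> x) \<or>
      fdim (?\<theta> x) < fdim x \<and> (\<forall>\<alpha>. ?\<theta> x \<in> ?\<theta> ` facets \<alpha> x)"
    proof (cases "k = 0 \<and> l = 0")
      case True
      have "?\<theta> x \<in> ?\<theta> ` facets \<alpha> x" for \<alpha>
      proof -
        have "letter \<alpha> # 0 # y \<in> facets \<alpha> x" "0 # letter (flip \<alpha>) # y \<in> facets \<alpha> x"
          using y(1) True by simp_all
        \<comment> \<open>The two facets fix one zero each, with opposite letters, so one of these
          letters is neutral and the remaining zero survives.\<close>
        moreover have "?\<theta> x = ?\<theta> (letter \<alpha> # 0 # y) \<or> ?\<theta> x = ?\<theta> (0 # letter (flip \<alpha>) # y)"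
          using y(1) True by (cases \<alpha>; cases \<beta>) simp_all
        ultimately show ?thesis by blast
      qed
      then show ?thesis using y(1) True by (cases \<beta>) auto
    next
      case False
      then show ?thesis using y(1-3) by (cases \<beta>) (auto simp: image_image letter_max_min)
    qed
  qed
next
  case (Suc j)
  then obtain m' where "m = Suc m'" "j \<le> m'" by (cases m) auto
  then show ?case using cubical_map_lift[OF Suc.IH[of m']] by simp
qed

text \<open>Monotonicity gives one inclusion. For the other, a proper subface of \<theta> x lies
  below the image of some facet of x, whether facets map onto facets or one facet has the same image
  as x, and induction applies to that facet.\<close>

lemma cubical_map_image:
  assumes \<theta>: "cubical_map m n \<theta>" and "x \<in> faces m"
  shows "\<theta> ` Rcl {x} = Rcl {\<theta> x}"
proof -
  have "v \<in> \<theta> ` Rcl {x}" if "face_le v (\<theta> x)" "x \<in> faces m" for v x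
    using that
  proof (induction "fdim x" arbitrary: x rule: less_induct)
    case less
    have sub: "v \<in> \<theta> ` Rcl {x}" if "z \<in> facets \<alpha> x" "face_le v (\<theta> z)" for z \<alpha>
    proof -
      have "z \<in> faces m" "face_le z x" "fdim z < fdim x"
        using that(1) less.prems facets_faces facets_le fdim_facets by auto
      then have "v \<in> \<theta> ` Rcl {z}" "Rcl {z} \<subseteq> Rcl {x}"
        using less.hyps[of z] that(2) less.prems(2) face_le_trans[of _ z x]
        by (auto simp: Rcl_singleton)
      then show ?thesis by blast
    qed
    show ?case
    proof (cases "v = \<theta> x")
      case True
      then show ?thesis using Rcl.base[of x "{x}"] by blast
    next
      case False
      then obtain \<alpha> z where z: "z \<in> facets \<alpha> (\<theta> x)" "face_le v z"
        using less.prems(1) face_le_neqE by metis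
      from cubical_mapD(3)[OF \<theta> less.prems(2)] have "\<exists>z'\<in>facets \<alpha> x. face_le v (\<theta> z')"
      proof (elim disjE conjE)
        assume "\<forall>\<alpha>. facets \<alpha> (\<theta> x) = \<theta> ` facets \<alpha> x"
        then show ?thesis using z by auto
      next
        assume "\<forall>\<alpha>. \<theta> x \<in> \<theta> ` facets \<alpha> x"
        then obtain z' where "z' \<in> facets \<alpha> x" "\<theta> x = \<theta> z'" by blast
        then show ?thesis using less.prems(1) by auto
      qed
      then show ?thesis using sub by blast
    qed
  qed
  then show ?thesis
    using cubical_mapD[OF assms] assms(2) by (auto simp: Rcl_singleton)
qed

lemma cubical_map_image_Rcl:
  assumes "cubical_map m n \<theta>" "X \<subseteq> faces m"
  shows "\<theta> ` Rcl X = Rcl (\<theta> ` X)"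
proof -
  have "\<theta> ` X \<subseteq> faces n" using assms cubical_mapD(1) by blast
  then have "Rcl (\<theta> ` X) = (\<Union>x\<in>X. Rcl {\<theta> x})"
    by (simp add: Rcl_UN)
  also have "\<dots> = (\<Union>x\<in>X. \<theta> ` Rcl {x})"
    using assms by (intro SUP_cong) (auto simp: cubical_map_image subset_iff)
  also have "\<dots> = \<theta> ` Rcl X"
    using Rcl_UN[OF assms(2)] by (simp add: image_UN)
  finally show ?thesis by simp
qed

section \<open>Omega-functors, and the functor induced by a map of words\<close>

lemma omega_functorsI:
  assumes "f \<in> extensional (cells C)" "\<And>x. x \<in> cells C \<Longrightarrow> f x \<in> cells D"
    "\<And>\<alpha> n x. x \<in> cells C \<Longrightarrow> f (bd C \<alpha> n x) = bd D \<alpha> n (f x)"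
    "\<And>n x y. composable C n x y \<Longrightarrow> f (comp C n x y) = comp D n (f x) (f y)"
  shows "f \<in> omega_functors C D"
  using assms by (auto simp: omega_functors_def PiE_iff)

lemma omega_functorsD:
  assumes "f \<in> omega_functors C D"
  shows "f \<in> extensional (cells C)" "x \<in> cells C \<Longrightarrow> f x \<in> cells D"
    "x \<in> cells C \<Longrightarrow> f (bd C \<alpha> n x) = bd D \<alpha> n (f x)"
    "composable C n x y \<Longrightarrow> f (comp C n x y) = comp D n (f x) (f y)"
  using assms by (auto simp: omega_functors_def PiE_iff)

lemma omega_functors_composable:
  assumes "f \<in> omega_functors C D" "composable C n x y"
  shows "composable D n (f x) (f y)"
proof -
  have "x \<in> cells C" "y \<in> cells C" "bd C Plus n x = bd C Minus n y"
    using assms(2) by (auto simp: composable_def)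
  then show ?thesis
    using omega_functorsD(2,3)[OF assms(1)] unfolding composable_def by metis
qed

lemma omega_functors_compose:
  assumes "omega_category C" "f \<in> omega_functors C D" "g \<in> omega_functors D E"
  shows "compose (cells C) g f \<in> omega_functors C E"
proof (rule omega_functorsI)
  interpret omega_category C by fact
  note f = omega_functorsD[OF assms(2)] and g = omega_functorsD[OF assms(3)]
  show "compose (cells C) g f \<in> extensional (cells C)" by (rule compose_extensional)
  show "compose (cells C) g f x \<in> cells E" if "x \<in> cells C" for x
    using that f(2) g(2) by (simp add: compose_eq)
  show "compose (cells C) g f (bd C \<alpha> n x) = bd E \<alpha> n (compose (cells C) g f x)"
    if "x \<in> cells C" for \<alpha> n x
    using that bd_closed f(2,3) g(3) by (simp add: compose_eq)
  show "compose (cells C) g f (comp C n x y) = comp E n (compose (cells C) g f x) (compose (cells C) g f y)"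
    if "composable C n x y" for n x y
    using that comp_closed composableD[OF that] f(4) g(4) omega_functors_composable[OF assms(2)]
    by (simp add: compose_eq)
qed

text \<open>On a face x there are three ranges of boundaries: from dim x on they are identities on
  both sides, in codimension one they are given by facets, and below that globularity replaces
  R({x}) by its codimension one boundary, a composite of smaller faces. The predicate
  \<open>P\<close> is therefore shown to pass to composites before faces are treated.\<close>

lemma cubical_map_functor:
  assumes I: "is_cube m I" and J: "is_cube n J" and \<theta>: "cubical_map m n \<theta>"
  shows "(\<lambda>S\<in>cells I. \<theta> ` S) \<in> omega_functors I J"
proof -
  interpret I: cube_category m I by standard fact
  interpret J: cube_category n J by standard fact
  define P where "P S \<longleftrightarrow> \<theta> ` S \<in> cells J \<and> (\<forall>\<alpha> p. \<theta> ` bd I \<alpha> p S = bd J \<alpha> p (\<theta> ` S))" for S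
  have composable: "composable J p (\<theta> ` S) (\<theta> ` T)" if "composable I p S T" "P S" "P T" for p S T
    using that I.composableD[OF that(1)] unfolding P_def composable_def by metis
  have comp_P: "P (S \<union> T)" if c: "composable I p S T" and S: "P S" and T: "P T" for p S T
  proof -
    note cJ = composable[OF c S T]
    have Un: "\<theta> ` (S \<union> T) = comp J p (\<theta> ` S) (\<theta> ` T)"
      using J.comp_eq[OF cJ] by (simp add: image_Un)
    have "\<theta> ` bd I \<alpha> q (S \<union> T) = bd J \<alpha> q (\<theta> ` (S \<union> T))" for \<alpha> q
    proof (cases "q = p")
      case True
      then show ?thesis
        unfolding Un using I.src_comp[OF c] I.tgt_comp[OF c] J.src_comp[OF cJ] J.tgt_comp[OF cJ]
          I.comp_eq[OF c] S T by (cases \<alpha>) (auto simp: P_def)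
    next
      case False
      have "bd I \<alpha> q (S \<union> T) = bd I \<alpha> q S \<union> bd I \<alpha> q T"
        using I.bd_comp[OF c False, of \<alpha>] I.comp_eq[OF c]
          I.comp_eq[OF I.composable_bd[OF c False, of \<alpha>]] by simp
      moreover have "bd J \<alpha> q (\<theta> ` (S \<union> T)) = bd J \<alpha> q (\<theta> ` S) \<union> bd J \<alpha> q (\<theta> ` T)"
        unfolding Un using J.bd_comp[OF cJ False, of \<alpha>]
          J.comp_eq[OF J.composable_bd[OF cJ False, of \<alpha>]] by simp
      ultimately show ?thesis using S T by (simp add: P_def image_Un)
    qed
    then show ?thesis using Un J.comp_closed[OF cJ] by (simp add: P_def)
  qed
  have gen: "P (Rcl {x})" if "x \<in> faces m" for x
    using that
  proof (induction "fdim x" arbitrary: x rule: less_induct)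
    case less
    note x = less.prems
    note cx = I.Rcl_cell[OF x] and \<theta>x = cubical_mapD(1)[OF \<theta> x]
    note c\<theta>x = J.Rcl_cell[OF \<theta>x] and img = cubical_map_image[OF \<theta> x]
    have dim: "fdim (\<theta> x) \<le> fdim x" using cubical_mapD(3)[OF \<theta> x] by auto
    have ge: "\<theta> ` bd I \<alpha> p (Rcl {x}) = bd J \<alpha> p (\<theta> ` Rcl {x})" if "fdim x \<le> p" for \<alpha> p
      using I.dim_le_mono[OF cx I.dim_le_Rcl[OF x] that]
        J.dim_le_mono[OF c\<theta>x J.dim_le_Rcl[OF \<theta>x], of p] dim that img
      by (simp add: I.dim_le_def J.dim_le_def)
    have eq: "\<theta> ` bd I \<alpha> p (Rcl {x}) = bd J \<alpha> p (\<theta> ` Rcl {x})" if p: "fdim x = Suc p" for \<alpha> p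
    proof -
      have f: "facets \<alpha> x \<subseteq> faces m" using facets_faces[OF x] by blast
      have l: "\<theta> ` bd I \<alpha> p (Rcl {x}) = Rcl (\<theta> ` facets \<alpha> x)"
        using I.bd_Rcl[OF x p, of \<alpha>] cubical_map_image_Rcl[OF \<theta> f] by simp
      from cubical_mapD(3)[OF \<theta> x] show ?thesis
      proof (elim disjE conjE)
        assume "fdim (\<theta> x) = fdim x" "\<forall>\<alpha>. facets \<alpha> (\<theta> x) = \<theta> ` facets \<alpha> x"
        then show ?thesis using l img J.bd_Rcl[OF \<theta>x, of p \<alpha>] p by simp
      next
        assume *: "fdim (\<theta> x) < fdim x" "\<forall>\<alpha>. \<theta> x \<in> \<theta> ` facets \<alpha> x"
        have "bd J \<alpha> p (Rcl {\<theta> x}) = Rcl {\<theta> x}"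
          using J.dim_le_mono[OF c\<theta>x J.dim_le_Rcl[OF \<theta>x], of p] * p by (simp add: J.dim_le_def)
        \<comment> \<open>A facet with the same image as x generates everything by itself; the other
          facets add nothing, by monotonicity.\<close>
        moreover have "Rcl (\<theta> ` facets \<alpha> x) = Rcl {\<theta> x}"
        proof
          have "\<theta> ` facets \<alpha> x \<subseteq> faces n" using f cubical_mapD(1)[OF \<theta>] by blast
          then have R: "Rcl (\<theta> ` facets \<alpha> x) = {w. \<exists>z\<in>facets \<alpha> x. face_le w (\<theta> z)}"
            using Rcl_faces by simp
          show "Rcl (\<theta> ` facets \<alpha> x) \<subseteq> Rcl {\<theta> x}"
            unfolding R Rcl_singleton[OF \<theta>x]
            using cubical_mapD(2)[OF \<theta> x facets_le] face_le_trans by blast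
          show "Rcl {\<theta> x} \<subseteq> Rcl (\<theta> ` facets \<alpha> x)"
            unfolding R Rcl_singleton[OF \<theta>x] using *(2)[rule_format, of \<alpha>] by force
        qed
        ultimately show ?thesis using l img by simp
      qed
    qed
    have lt: "\<theta> ` bd I \<alpha> p (Rcl {x}) = bd J \<alpha> p (\<theta> ` Rcl {x})" if p: "fdim x = Suc q" "p < q" for \<alpha> p q
    proof -
      let ?T = "Rcl (facets \<alpha> x)"
      have T: "?T \<in> cells I" "\<And>w. w \<in> ?T \<Longrightarrow> face_le w x \<and> fdim w < fdim x"
        using I.facet_cell[OF x, where \<alpha> = \<alpha>] p by simp_all
      have "P ?T" using T(1)
      proof (induction rule: I.cell_induct)
        case (gen w)
        then show ?case using T(2)[of w] less.hyps[of w] by blast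
      next
        case (comp r S T)
        then show ?case using comp_P by blast
      qed
      then have "\<theta> ` bd I \<alpha> p ?T = bd J \<alpha> p (\<theta> ` ?T)" by (simp add: P_def)
      moreover have "?T = bd I \<alpha> q (Rcl {x})" using I.bd_Rcl[OF x p(1), of \<alpha>] by simp
      ultimately show ?thesis
        using eq[OF p(1), of \<alpha>] I.bd_bd_less[OF cx p(2), of \<alpha> \<alpha>] J.bd_bd_less[OF c\<theta>x p(2), of \<alpha> \<alpha>] img
        by simp
    qed
    have "\<theta> ` bd I \<alpha> p (Rcl {x}) = bd J \<alpha> p (\<theta> ` Rcl {x})" for \<alpha> p
    proof (cases "fdim x \<le> p")
      case False
      then obtain q where "fdim x = Suc q" "p \<le> q" by (cases "fdim x") auto
      then show ?thesis using eq[of q \<alpha>] lt[of q p \<alpha>] by (cases "p = q") auto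
    qed (rule ge)
    then show ?case using img c\<theta>x by (simp add: P_def)
  qed
  have P: "P S" if "S \<in> cells I" for S
    using that by (induction rule: I.cell_induct) (auto intro: gen comp_P)
  show ?thesis
  proof (rule omega_functorsI)
    show "(\<lambda>S\<in>cells I. \<theta> ` S) (comp I p S T) =
        comp J p ((\<lambda>S\<in>cells I. \<theta> ` S) S) ((\<lambda>S\<in>cells I. \<theta> ` S) T)" if "composable I p S T" for p S T
      using I.composableD[OF that] I.comp_closed[OF that] I.comp_eq[OF that]
        J.comp_eq[OF composable[OF that P P]] by (simp add: image_Un)
  qed (use P I.bd_closed in \<open>auto simp: P_def\<close>)
qed

section \<open>Identities between cubical operations\<close>

text \<open>Cubes are reindexed contravariantly, so this and the following identities list the word
  maps in the order opposite to the operations on cubes.\<close>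

lemma insert_insert:
  "i \<le> j \<Longrightarrow> j \<le> length k \<Longrightarrow>
   insert_letter (Suc j) a (insert_letter i b k) = insert_letter i b (insert_letter j a k)"
proof (induction i arbitrary: j k)
  case (Suc i)
  then show ?case by (cases j; cases k) auto
qed simp

lemma delete_insert_same: "j \<le> length k \<Longrightarrow> delete_letter j (insert_letter j a k) = k"
proof (induction j arbitrary: k)
  case (Suc j)
  then show ?case by (cases k) auto
qed simp

lemma delete_insert_less:
  "i \<le> j \<Longrightarrow> j < length k \<Longrightarrow>
   delete_letter (Suc j) (insert_letter i a k) = insert_letter i a (delete_letter j k)"
proof (induction i arbitrary: j k)
  case (Suc i)
  then show ?case by (cases j; cases k) auto
qed simp

lemma delete_insert_greater:
  "j \<le> i \<Longrightarrow> i < length k \<Longrightarrow>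
   delete_letter j (insert_letter (Suc i) a k) = insert_letter i a (delete_letter j k)"
proof (induction j arbitrary: i k)
  case 0
  then show ?case by (cases k) auto
next
  case (Suc j)
  then show ?case by (cases i; cases k) auto
qed

lemma merge_insert_less:
  "i \<le> j \<Longrightarrow> Suc j < length k \<Longrightarrow>
   merge_letters f (Suc j) (insert_letter i a k) = insert_letter i a (merge_letters f j k)"
proof (induction i arbitrary: j k)
  case (Suc i)
  then show ?case by (cases j; cases k) auto
qed simp

lemma merge_insert_greater:
  "j < i \<Longrightarrow> i < length k \<Longrightarrow>
   merge_letters f j (insert_letter (Suc i) a k) = insert_letter i a (merge_letters f j k)"
proof (induction j arbitrary: i k)
  case 0
  then obtain i' where i: "i = Suc i'" by (cases i) auto
  obtain b c k' where "k = b # c # k'" using 0 i by (cases k; cases "tl k") auto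
  then show ?case using i by simp
next
  case (Suc j)
  then show ?case by (cases i; cases k) auto
qed

text \<open>The neutral letter makes the two faces of a connection with its own sign return the
  cube; the absorbing letter makes the two opposite faces degenerate.\<close>

lemma join_letter:
  assumes "b \<in> {-1, 0, 1}"
  shows "join_letters \<alpha> (letter \<alpha>) b = b" "join_letters \<alpha> b (letter \<alpha>) = b"
    "join_letters \<alpha> (letter (flip \<alpha>)) b = letter (flip \<alpha>)" "join_letters \<alpha> b (letter (flip \<alpha>)) = letter (flip \<alpha>)"
  using assms by (cases \<alpha>; auto)+

lemma merge_insert_same:
  assumes "j \<le> n" "k \<in> faces (Suc n)"
  shows "merge_letters (join_letters \<alpha>) j (insert_letter j (letter \<alpha>) k) = k"
    "merge_letters (join_letters \<alpha>) j (insert_letter (Suc j) (letter \<alpha>) k) = k"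
    "merge_letters (join_letters \<alpha>) j (insert_letter j (letter (flip \<alpha>)) k) =
       insert_letter j (letter (flip \<alpha>)) (delete_letter j k)"
    "merge_letters (join_letters \<alpha>) j (insert_letter (Suc j) (letter (flip \<alpha>)) k) =
       insert_letter j (letter (flip \<alpha>)) (delete_letter j k)"
proof -
  have "merge_letters (join_letters \<alpha>) j (insert_letter j (letter \<alpha>) k) = k \<and>
    merge_letters (join_letters \<alpha>) j (insert_letter (Suc j) (letter \<alpha>) k) = k \<and>
    merge_letters (join_letters \<alpha>) j (insert_letter j (letter (flip \<alpha>)) k) =
       insert_letter j (letter (flip \<alpha>)) (delete_letter j k) \<and>
    merge_letters (join_letters \<alpha>) j (insert_letter (Suc j) (letter (flip \<alpha>)) k) =
       insert_letter j (letter (flip \<alpha>)) (delete_letter j k)"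
    using assms
  proof (induction j arbitrary: n k)
    case 0
    then obtain b k' where "k = b # k'" "b \<in> {-1, 0, 1}" by (metis faces_SucE)
    then show ?case by (simp add: join_letter)
  next
    case (Suc j)
    then obtain n' where n: "n = Suc n'" by (cases n) auto
    from Suc.prems(2) obtain b k' where "k = b # k'" "k' \<in> faces n" by (metis faces_SucE)
    then show ?case using Suc.IH[of n' k'] Suc.prems n by simp
  qed
  then show "merge_letters (join_letters \<alpha>) j (insert_letter j (letter \<alpha>) k) = k"
    "merge_letters (join_letters \<alpha>) j (insert_letter (Suc j) (letter \<alpha>) k) = k"
    "merge_letters (join_letters \<alpha>) j (insert_letter j (letter (flip \<alpha>)) k) =
       insert_letter j (letter (flip \<alpha>)) (delete_letter j k)"
    "merge_letters (join_letters \<alpha>) j (insert_letter (Suc j) (letter (flip \<alpha>)) k) =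
       insert_letter j (letter (flip \<alpha>)) (delete_letter j k)"
    by blast+
qed

lemma join_assoc: "join_letters \<alpha> (join_letters \<alpha> a b) c = join_letters \<alpha> a (join_letters \<alpha> b c)"
  by (cases \<alpha>) (simp_all add: max.assoc min.assoc)

text \<open>Only i = j has content: three adjacent letters are joined, and \<open>max\<close> and
  \<open>min\<close> are associative.\<close>

lemma merge_merge:
  "i \<le> j \<Longrightarrow> Suc (Suc j) < length k \<Longrightarrow>
   merge_letters (join_letters \<alpha>) j (merge_letters (join_letters \<alpha>) i k) =
   merge_letters (join_letters \<alpha>) i (merge_letters (join_letters \<alpha>) (Suc j) k)"
proof (induction i arbitrary: j k)
  case 0
  then obtain a b c k' where k: "k = a # b # c # k'"
    by (cases k rule: list.exhaust; cases "tl k"; cases "tl (tl k)") auto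
  then show ?case by (cases j) (simp_all add: join_assoc)
next
  case (Suc i)
  then show ?case by (cases j; cases k) auto
qed

section \<open>Singular cubes and the identities between their operations\<close>

locale cubical_nerve =
  fixes I :: cubes
  assumes cubes: "is_cube n (I n)"
begin

lemma cube_Rcl: "k \<in> faces n \<Longrightarrow> Rcl {k} \<in> cells (I n)"
  using cubes by (rule is_cubeD)

lemma scube_eqI:
  assumes x: "x \<in> scubes I C n" and y: "y \<in> scubes I C n"
    and eq: "\<And>k. k \<in> faces n \<Longrightarrow> x (Rcl {k}) = y (Rcl {k})"
  shows "x = y"
proof (rule extensionalityI)
  interpret cube_category n "I n" by standard (rule cubes)
  note x = x[unfolded scubes_def] and y = y[unfolded scubes_def]
  show "x \<in> extensional (cells (I n))" "y \<in> extensional (cells (I n))"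
    using omega_functorsD(1) x y by blast+
  fix S assume "S \<in> cells (I n)"
  then show "x S = y S"
  proof (induction rule: cell_induct)
    case (gen k)
    then show ?case using eq by blast
  next
    case (comp p S T)
    then show ?case
      using omega_functorsD(4)[OF x comp(1)] omega_functorsD(4)[OF y comp(1)] comp_eq[OF comp(1)]
      by simp
  qed
qed

text \<open>Makes the definite description usable: composing x with the functor induced by \<theta>
  provides existence, and agreement on faces provides uniqueness.\<close>

lemma reindex:
  assumes \<theta>: "cubical_map m n \<theta>" and x: "x \<in> scubes I C n"
  shows "reindex I C m \<theta> x \<in> scubes I C m"
    "k \<in> faces m \<Longrightarrow> reindex I C m \<theta> x (Rcl {k}) = x (Rcl {\<theta> k})"
proof -
  interpret m: cube_category m "I m" by standard (rule cubes)
  let ?F = "\<lambda>S\<in>cells (I m). \<theta> ` S"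
  let ?z = "compose (cells (I m)) x ?F"
  have z: "?z \<in> scubes I C m"
    unfolding scubes_def
  proof (rule omega_functors_compose)
    show "omega_category (I m)" by (rule m.omega_category_axioms)
    show "?F \<in> omega_functors (I m) (I n)"
      using cubes cubes \<theta> by (rule cubical_map_functor)
    show "x \<in> omega_functors (I n) C" using x by (simp add: scubes_def)
  qed
  have z': "?z (Rcl {k}) = x (Rcl {\<theta> k})" if "k \<in> faces m" for k
    using cube_Rcl[OF that] cubical_map_image[OF \<theta> that] by (simp add: compose_eq)
  have "\<exists>!z. z \<in> scubes I C m \<and> (\<forall>k\<in>faces m. z (Rcl {k}) = x (Rcl {\<theta> k}))"
  proof (rule ex1I)
    show "?z \<in> scubes I C m \<and> (\<forall>k\<in>faces m. ?z (Rcl {k}) = x (Rcl {\<theta> k}))" using z z' by blast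
    fix w assume w: "w \<in> scubes I C m \<and> (\<forall>k\<in>faces m. w (Rcl {k}) = x (Rcl {\<theta> k}))"
    show "w = ?z" by (rule scube_eqI) (use w z z' in auto)
  qed
  from theI'[OF this] show "reindex I C m \<theta> x \<in> scubes I C m"
    "k \<in> faces m \<Longrightarrow> reindex I C m \<theta> x (Rcl {k}) = x (Rcl {\<theta> k})"
    unfolding reindex_def by blast+
qed

text \<open>Cubes number their coordinates from 1 and words from 0. Writing dimension and index as
  successors removes the truncated subtractions from the definitions.\<close>

lemma cface_eq: "cface I C \<alpha> (Suc n) (Suc j) = reindex I C n (insert_letter j (letter \<alpha>))"
  by (simp add: cface_def insert_letter_def[abs_def])

lemma cdegen_eq: "cdegen I C n (Suc j) = reindex I C (Suc n) (delete_letter j)"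
  by (simp add: cdegen_def delete_letter_def[abs_def])

lemma connection_eq:
  "connection I C \<alpha> (Suc n) (Suc j) = reindex I C (Suc (Suc n)) (merge_letters (join_letters \<alpha>) j)"
  by (cases \<alpha>) (simp_all add: connection_def merge_letters_def[abs_def])

lemma cface:
  assumes "x \<in> scubes I C (Suc n)" "j \<le> n"
  shows "cface I C \<alpha> (Suc n) (Suc j) x \<in> scubes I C n"
    "k \<in> faces n \<Longrightarrow> cface I C \<alpha> (Suc n) (Suc j) x (Rcl {k}) = x (Rcl {insert_letter j (letter \<alpha>) k})"
  using reindex[OF cubical_map_insert assms(1)] assms(2) unfolding cface_eq by blast+

lemma cdegen:
  assumes "x \<in> scubes I C n" "j \<le> n"
  shows "cdegen I C n (Suc j) x \<in> scubes I C (Suc n)"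
    "k \<in> faces (Suc n) \<Longrightarrow> cdegen I C n (Suc j) x (Rcl {k}) = x (Rcl {delete_letter j k})"
  using reindex[OF cubical_map_delete assms(1)] assms(2) unfolding cdegen_eq by blast+

lemma connection:
  assumes "x \<in> scubes I C (Suc n)" "j \<le> n"
  shows "connection I C \<alpha> (Suc n) (Suc j) x \<in> scubes I C (Suc (Suc n))"
    "k \<in> faces (Suc (Suc n)) \<Longrightarrow>
     connection I C \<alpha> (Suc n) (Suc j) x (Rcl {k}) = x (Rcl {merge_letters (join_letters \<alpha>) j k})"
  using reindex[OF cubical_map_merge assms(1)] assms(2) unfolding connection_eq by blast+

lemmas insert_faces = cubical_mapD(1)[OF cubical_map_insert]
lemmas delete_faces = cubical_mapD(1)[OF cubical_map_delete]
lemmas merge_faces = cubical_mapD(1)[OF cubical_map_merge]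

lemma cface_cface:
  assumes x: "x \<in> scubes I C (Suc (Suc n))" and "i \<le> j" "j \<le> n"
  shows "cface I C \<alpha> (Suc n) (Suc i) (cface I C \<beta> (Suc (Suc n)) (Suc (Suc j)) x) =
    cface I C \<beta> (Suc n) (Suc j) (cface I C \<alpha> (Suc (Suc n)) (Suc i) x)"
  using assms
  by (intro scube_eqI[of _ C n])
     (simp_all add: cface insert_faces insert_insert length_faces)

lemma cface_cdegen_same:
  assumes "x \<in> scubes I C n" "j \<le> n"
  shows "cface I C \<alpha> (Suc n) (Suc j) (cdegen I C n (Suc j) x) = x"
  using assms
  by (intro scube_eqI[of _ C n])
     (simp_all add: cface cdegen insert_faces delete_insert_same length_faces)

lemma cface_cdegen_less:
  assumes "x \<in> scubes I C (Suc n)" "i \<le> j" "j \<le> n"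
  shows "cface I C \<alpha> (Suc (Suc n)) (Suc i) (cdegen I C (Suc n) (Suc (Suc j)) x) =
    cdegen I C n (Suc j) (cface I C \<alpha> (Suc n) (Suc i) x)"
  using assms
  by (intro scube_eqI[of _ C "Suc n"])
     (simp_all add: cface cdegen insert_faces delete_faces delete_insert_less length_faces)

lemma cface_cdegen_greater:
  assumes "x \<in> scubes I C (Suc n)" "j \<le> i" "i \<le> n"
  shows "cface I C \<alpha> (Suc (Suc n)) (Suc (Suc i)) (cdegen I C (Suc n) (Suc j) x) =
    cdegen I C n (Suc j) (cface I C \<alpha> (Suc n) (Suc i) x)"
  using assms
  by (intro scube_eqI[of _ C "Suc n"])
     (simp_all add: cface cdegen insert_faces delete_faces delete_insert_greater length_faces)

lemma cface_connection_same:
  assumes "x \<in> scubes I C (Suc n)" "j \<le> n" "i = j \<or> i = Suc j"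
  shows "cface I C \<alpha> (Suc (Suc n)) (Suc i) (connection I C \<alpha> (Suc n) (Suc j) x) = x"
proof (rule scube_eqI)
  show "cface I C \<alpha> (Suc (Suc n)) (Suc i) (connection I C \<alpha> (Suc n) (Suc j) x) \<in> scubes I C (Suc n)"
    using assms by (intro cface connection) auto
  fix k assume k: "k \<in> faces (Suc n)"
  have "i \<le> Suc n" using assms by auto
  then show "cface I C \<alpha> (Suc (Suc n)) (Suc i) (connection I C \<alpha> (Suc n) (Suc j) x) (Rcl {k}) = x (Rcl {k})"
    using assms k insert_faces[of i "Suc n" k]
      merge_insert_same(1,2)[of j n k \<alpha>] by (auto simp: cface(2)[OF connection(1)] connection(2))
qed (rule assms)

lemma cface_connection_flip:
  assumes "x \<in> scubes I C (Suc n)" "j \<le> n" "i = j \<or> i = Suc j"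
  shows "cface I C (flip \<alpha>) (Suc (Suc n)) (Suc i) (connection I C \<alpha> (Suc n) (Suc j) x) =
    cdegen I C n (Suc j) (cface I C (flip \<alpha>) (Suc n) (Suc j) x)"
proof (rule scube_eqI)
  show "cface I C (flip \<alpha>) (Suc (Suc n)) (Suc i) (connection I C \<alpha> (Suc n) (Suc j) x) \<in> scubes I C (Suc n)"
    using assms by (intro cface connection) auto
  show "cdegen I C n (Suc j) (cface I C (flip \<alpha>) (Suc n) (Suc j) x) \<in> scubes I C (Suc n)"
    using assms by (intro cface cdegen) auto
  fix k assume k: "k \<in> faces (Suc n)"
  have "i \<le> Suc n" using assms by auto
  then show "cface I C (flip \<alpha>) (Suc (Suc n)) (Suc i) (connection I C \<alpha> (Suc n) (Suc j) x) (Rcl {k}) =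
      cdegen I C n (Suc j) (cface I C (flip \<alpha>) (Suc n) (Suc j) x) (Rcl {k})"
    using assms k insert_faces[of i "Suc n" k] delete_faces[of j n k]
      merge_insert_same(3,4)[of j n k \<alpha>]
    by (auto simp: cface(2)[OF connection(1)] connection(2) cdegen(2)[OF cface(1)] cface(2))
qed

lemma cface_connection_less:
  assumes "x \<in> scubes I C (Suc (Suc n))" "i \<le> j" "j \<le> n"
  shows "cface I C \<beta> (Suc (Suc (Suc n))) (Suc i) (connection I C \<alpha> (Suc (Suc n)) (Suc (Suc j)) x) =
    connection I C \<alpha> (Suc n) (Suc j) (cface I C \<beta> (Suc (Suc n)) (Suc i) x)"
  using assms
  by (intro scube_eqI[of _ C "Suc (Suc n)"])
     (simp_all add: cface connection insert_faces merge_faces merge_insert_less length_faces)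

lemma cface_connection_greater:
  assumes "x \<in> scubes I C (Suc (Suc n))" "j < i" "i \<le> Suc n"
  shows "cface I C \<beta> (Suc (Suc (Suc n))) (Suc (Suc i)) (connection I C \<alpha> (Suc (Suc n)) (Suc j) x) =
    connection I C \<alpha> (Suc n) (Suc j) (cface I C \<beta> (Suc (Suc n)) (Suc i) x)"
  using assms
  by (intro scube_eqI[of _ C "Suc (Suc n)"])
     (simp_all add: cface connection insert_faces merge_faces merge_insert_greater length_faces)

lemma connection_connection:
  assumes "x \<in> scubes I C (Suc n)" "i \<le> j" "j \<le> n"
  shows "connection I C \<alpha> (Suc (Suc n)) (Suc i) (connection I C \<alpha> (Suc n) (Suc j) x) =
    connection I C \<alpha> (Suc (Suc n)) (Suc (Suc j)) (connection I C \<alpha> (Suc n) (Suc i) x)"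
  using assms
  by (intro scube_eqI[of _ C "Suc (Suc (Suc n))"])
     (simp_all add: connection merge_faces merge_merge length_faces)

section \<open>Degenerate cubes, and nondegeneracy of connections\<close>

lemma degenerate_Suc:
  "degenerate I C (Suc n) x \<longleftrightarrow> (\<exists>j\<le>n. \<exists>z\<in>scubes I C n. x = cdegen I C n (Suc j) z)"
proof -
  have "{1..Suc n} = Suc ` {..n}" by (auto simp: image_iff Suc_le_eq gr0_conv_Suc)
  then show ?thesis by (auto simp: degenerate_def)
qed

lemma degenerate_cdegen:
  "z \<in> scubes I C n \<Longrightarrow> j \<le> n \<Longrightarrow> degenerate I C (Suc n) (cdegen I C n (Suc j) z)"
  using degenerate_Suc by blast

lemma not_degenerate_0: "\<not> degenerate I C 0 x"
  by (simp add: degenerate_def)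

text \<open>A face commutes with a degeneracy in any other direction. The last assumption excludes
  the direction of the face for every z, because the same cube may be degenerate in several
  directions.\<close>

lemma cface_degenerate:
  assumes "degenerate I C (Suc (Suc n)) x" "i \<le> Suc n"
    and "\<And>z. z \<in> scubes I C (Suc n) \<Longrightarrow> x \<noteq> cdegen I C (Suc n) (Suc i) z"
  shows "degenerate I C (Suc n) (cface I C \<alpha> (Suc (Suc n)) (Suc i) x)"
proof -
  obtain j z where z: "j \<le> Suc n" "z \<in> scubes I C (Suc n)" "x = cdegen I C (Suc n) (Suc j) z"
    using assms(1) degenerate_Suc by blast
  then have "i \<noteq> j" using assms(3) by blast
  then consider j' where "j = Suc j'" "i \<le> j'" "j' \<le> n" | i' where "i = Suc i'" "j \<le> i'" "i' \<le> n"
    using assms(2) z(1) by (cases j; cases i; fastforce)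
  then show ?thesis
  proof cases
    case 1
    then show ?thesis
      using z cface_cdegen_less[OF z(2), of i j' \<alpha>] cface(1)[OF z(2), of i \<alpha>]
      by (simp add: degenerate_cdegen)
  next
    case 2
    then show ?thesis
      using z cface_cdegen_greater[OF z(2), of j i' \<alpha>] cface(1)[OF z(2), of i' \<alpha>]
      by (simp add: degenerate_cdegen)
  qed
qed

lemma connection_not_degenerate:
  assumes x: "x \<in> scubes I C (Suc n)" "\<not> degenerate I C (Suc n) x" and j: "j \<le> n"
  shows "\<not> degenerate I C (Suc (Suc n)) (connection I C \<alpha> (Suc n) (Suc j) x)"
proof
  let ?y = "connection I C \<alpha> (Suc n) (Suc j) x"
  assume d: "degenerate I C (Suc (Suc n)) ?y"
  show False
  proof (cases "\<exists>z\<in>scubes I C (Suc n). ?y = cdegen I C (Suc n) (Suc j) z")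
    \<comment> \<open>A degeneracy in another direction survives the face of sign \<alpha> in
      direction j + 1, and that face is x.\<close>
    case False
    then show ?thesis
      using cface_degenerate[OF d, of j \<alpha>] cface_connection_same[OF x(1) j, of j \<alpha>] x(2) j by auto
  next
    case True
    then obtain z where z: "z \<in> scubes I C (Suc n)" "?y = cdegen I C (Suc n) (Suc j) z" by blast
    then have "z = x"
      using cface_cdegen_same[OF z(1), of j \<alpha>] cface_connection_same[OF x(1) j, of j \<alpha>] j by simp
    then have "x = cdegen I C n (Suc j) (cface I C (flip \<alpha>) (Suc n) (Suc j) x)"
      using cface_cdegen_same[OF z(1), of j "flip \<alpha>"] cface_connection_flip[OF x(1) j, of j \<alpha>] j z(2)
      by simp
    then show ?thesis using x j cface(1)[OF x(1) j] degenerate_cdegen by metis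
  qed
qed

section \<open>Corner cubes and the simplicial structure on them\<close>

lemma corner_cubes_0:
  fixes C :: "'c ocat"
  shows "corner_cubes I C \<alpha> 0 = scubes I C 0"
proof -
  have "m = 0" if "iterated_face I C \<alpha> 0 x m y" for m and x y :: "'c cube"
    using that by induction auto
  then have "\<not> degenerate I C m y" if "iterated_face I C \<alpha> 0 x m y" for m and x y :: "'c cube"
    using that not_degenerate_0 by metis
  then show ?thesis unfolding corner_cubes_def by blast
qed

text \<open>Chains of faces grow at their far end, whereas a recursion over the dimension of x has
  to split off the first face. This lemma and the next one pass between the two views.\<close>

lemma iterated_face_cface:
  assumes "iterated_face I C \<alpha> n (cface I C \<alpha> (Suc n) (Suc j) x) m y" "j \<le> n"
  shows "iterated_face I C \<alpha> (Suc n) x m y"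
  using assms(1)
proof induction
  case refl
  have "iterated_face I C \<alpha> (Suc n) x n (cface I C \<alpha> (Suc n) (Suc j) x)"
    by (rule iterated_face.step[OF iterated_face.refl]) (use assms in auto)
  then show ?case .
qed (rule iterated_face.step)

lemma iterated_face_Suc:
  assumes "iterated_face I C \<alpha> (Suc n) x m y"
  shows "m = Suc n \<and> y = x \<or> (\<exists>j\<le>n. iterated_face I C \<alpha> n (cface I C \<alpha> (Suc n) (Suc j) x) m y)"
  using assms
proof induction
  case (step m y i)
  then obtain j where j: "i = Suc j" "j \<le> m" by (cases i) auto
  show ?case using step.IH
  proof (elim disjE exE conjE)
    assume "Suc m = Suc n" "y = x"
    then show ?thesis using j iterated_face.refl by blast
  next
    fix l assume "l \<le> n" "iterated_face I C \<alpha> n (cface I C \<alpha> (Suc n) (Suc l) x) (Suc m) y"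
    then show ?thesis using iterated_face.step step.hyps(2) by blast
  qed
qed simp

text \<open>Replaces the quantification over all chains of faces by a recursion on the dimension,
  the form in which closure properties are proved by induction.\<close>

lemma corner_cubes_Suc:
  "x \<in> corner_cubes I C \<alpha> (Suc n) \<longleftrightarrow> x \<in> scubes I C (Suc n) \<and> \<not> degenerate I C (Suc n) x \<and>
     (\<forall>j\<le>n. cface I C \<alpha> (Suc n) (Suc j) x \<in> corner_cubes I C \<alpha> n)" (is "?L \<longleftrightarrow> ?R")
proof
  assume ?L
  then have x: "x \<in> scubes I C (Suc n)"
      "\<And>m y. iterated_face I C \<alpha> (Suc n) x m y \<Longrightarrow> \<not> degenerate I C m y"
    by (auto simp: corner_cubes_def)
  then show ?R
    using cface(1) iterated_face_cface iterated_face.refl[of I C \<alpha> "Suc n" x]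
    unfolding corner_cubes_def by blast
next
  assume R: ?R
  have "\<not> degenerate I C m y" if "iterated_face I C \<alpha> (Suc n) x m y" for m y
    using iterated_face_Suc[OF that] R unfolding corner_cubes_def by auto
  then show ?L using R by (simp add: corner_cubes_def)
qed

lemma corner_cubes_scubes: "x \<in> corner_cubes I C \<alpha> n \<Longrightarrow> x \<in> scubes I C n"
  by (simp add: corner_cubes_def)

text \<open>Each face of sign \<alpha> of the connection is x itself or a connection of a face of x,
  to which induction applies. For an edge x only the first kind occurs, which is why the base case
  is an edge.\<close>

lemma connection_corner:
  "x \<in> corner_cubes I C \<alpha> (Suc n) \<Longrightarrow> j \<le> n \<Longrightarrow>
   connection I C \<alpha> (Suc n) (Suc j) x \<in> corner_cubes I C \<alpha> (Suc (Suc n))"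
proof (induction n arbitrary: x j)
  case (0 x j)
  then have x: "x \<in> scubes I C (Suc 0)" "\<not> degenerate I C (Suc 0) x" and j: "j = 0"
    using corner_cubes_Suc by blast+
  have "cface I C \<alpha> (Suc (Suc 0)) (Suc i) (connection I C \<alpha> (Suc 0) (Suc 0) x)
      \<in> corner_cubes I C \<alpha> (Suc 0)" if "i \<le> Suc 0" for i
    using cface_connection_same[OF x(1), of 0 i \<alpha>] that 0 by (auto simp: le_Suc_eq)
  then show ?case
    unfolding corner_cubes_Suc[of _ _ _ "Suc 0"] j
    using connection(1)[OF x(1), of 0 \<alpha>] connection_not_degenerate[OF x, of 0 \<alpha>] by simp
next
  case (Suc n x j)
  have x: "x \<in> scubes I C (Suc (Suc n))" "\<not> degenerate I C (Suc (Suc n)) x"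
    "\<And>i. i \<le> Suc n \<Longrightarrow> cface I C \<alpha> (Suc (Suc n)) (Suc i) x \<in> corner_cubes I C \<alpha> (Suc n)"
    using Suc.prems corner_cubes_Suc by blast+
  have "cface I C \<alpha> (Suc (Suc (Suc n))) (Suc i) (connection I C \<alpha> (Suc (Suc n)) (Suc j) x)
      \<in> corner_cubes I C \<alpha> (Suc (Suc n))" if "i \<le> Suc (Suc n)" for i
  proof -
    consider "i = j \<or> i = Suc j" | j' where "j = Suc j'" "i \<le> j'" | i' where "i = Suc i'" "j < i'"
      by (cases i; cases j; fastforce)
    then show ?thesis
    proof cases
      case 1
      then show ?thesis using cface_connection_same[OF x(1)] Suc.prems by simp
    next
      case 2
      then show ?thesis
        using cface_connection_less[OF x(1), of i j' \<alpha> \<alpha>] Suc.IH[OF x(3)[of i], of j'] Suc.prems by simp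
    next
      case 3
      then show ?thesis
        using cface_connection_greater[OF x(1), of j i' \<alpha> \<alpha>] Suc.IH[OF x(3)[of i'], of j] that by simp
    qed
  qed
  then show ?case
    unfolding corner_cubes_Suc[of _ _ _ "Suc (Suc n)"]
    using connection(1)[OF x(1)] connection_not_degenerate[OF x(1,2)] Suc.prems by blast
qed

text \<open>Faces and connections carry the same sign. This is what makes both faces adjacent to a
  degeneracy return the simplex; faces of the opposite sign would be degenerate cubes.\<close>

lemma corner_nerve_simplicial: "simplicial_set (corner_nerve I C \<alpha>)"
proof
  let ?X = "corner_nerve I C \<alpha>"
  have simps: "simplices ?X n = corner_cubes I C \<alpha> (Suc n)"
    "sface ?X n i = cface I C \<alpha> (Suc n) (Suc i)"
    "sdegen ?X n i = connection I C \<alpha> (Suc n) (Suc i)" for n i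
    by (simp_all add: corner_nerve_def)
  fix n i j x
  show "sface ?X (Suc n) i x \<in> simplices ?X n" if "x \<in> simplices ?X (Suc n)" "i \<le> Suc n"
    using that corner_cubes_Suc unfolding simps by blast
  show "sdegen ?X n i x \<in> simplices ?X (Suc n)" if "x \<in> simplices ?X n" "i \<le> n"
    using that connection_corner unfolding simps by blast
  show "sface ?X (Suc n) i (sface ?X (Suc (Suc n)) j x) =
      sface ?X (Suc n) (j - 1) (sface ?X (Suc (Suc n)) i x)"
    if "x \<in> simplices ?X (Suc (Suc n))" "i < j" "j \<le> Suc (Suc n)"
    using that cface_cface[OF corner_cubes_scubes, of x C \<alpha> "Suc n" i "j - 1" \<alpha> \<alpha>]
    unfolding simps by (cases j) auto
  show "sdegen ?X (Suc n) i (sdegen ?X n j x) = sdegen ?X (Suc n) (j + 1) (sdegen ?X n i x)"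
    if "x \<in> simplices ?X n" "i \<le> j" "j \<le> n"
    using that connection_connection[OF corner_cubes_scubes] unfolding simps by simp
  show "sface ?X (Suc (Suc n)) i (sdegen ?X (Suc n) j x) = sdegen ?X n (j - 1) (sface ?X (Suc n) i x)"
    if "x \<in> simplices ?X (Suc n)" "i < j" "j \<le> Suc n"
    using that cface_connection_less[OF corner_cubes_scubes, of x C \<alpha> n i "j - 1" \<alpha> \<alpha>]
    unfolding simps by (cases j) auto
  show "sface ?X (Suc n) j (sdegen ?X n j x) = x" if "x \<in> simplices ?X n" "j \<le> n"
    using that unfolding simps by (intro cface_connection_same corner_cubes_scubes) auto
  show "sface ?X (Suc n) (j + 1) (sdegen ?X n j x) = x" if "x \<in> simplices ?X n" "j \<le> n"
    using that unfolding simps by (intro cface_connection_same corner_cubes_scubes) auto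
  show "sface ?X (Suc (Suc n)) i (sdegen ?X (Suc n) j x) = sdegen ?X n j (sface ?X (Suc n) (i - 1) x)"
    if "x \<in> simplices ?X (Suc n)" "j + 1 < i" "i \<le> Suc (Suc n)"
    using that cface_connection_greater[OF corner_cubes_scubes, of x C \<alpha> n j "i - 1" \<alpha> \<alpha>]
    unfolding simps by (cases i) auto
qed

section \<open>Edges and the dimension of their values\<close>

lemma edge_value:
  assumes x: "x \<in> scubes I C (Suc 0)"
  shows "bd C \<alpha> 0 (x (Rcl {[0]})) = x (Rcl {[letter \<alpha>]})" "bd C \<alpha> (Suc 0) (x (Rcl {[0]})) = x (Rcl {[0]})"
proof -
  interpret E: cube_category "Suc 0" "I (Suc 0)" by standard (rule cubes)
  have 0: "[0] \<in> faces (Suc 0)" "[letter \<alpha>] \<in> faces (Suc 0)" using letter_in[of \<alpha>] by auto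
  note x = x[unfolded scubes_def]
  show "bd C \<alpha> 0 (x (Rcl {[0]})) = x (Rcl {[letter \<alpha>]})"
    using omega_functorsD(3)[OF x E.Rcl_cell[OF 0(1)], of \<alpha> 0] E.bd_0_Rcl[OF 0(1), of \<alpha>]
      Rcl_vertex[OF 0(2)] by simp
  show "bd C \<alpha> (Suc 0) (x (Rcl {[0]})) = x (Rcl {[0]})"
    using omega_functorsD(3)[OF x E.Rcl_cell[OF 0(1)], of \<alpha> "Suc 0"] E.dim_le_Rcl[OF 0(1)]
    by (simp add: E.dim_le_def)
qed

text \<open>Translates degeneracy of an edge into the dimension of a cell of C, the notion in which
  non 1-contracting functors are defined.\<close>

lemma edge_dim:
  assumes x: "x \<in> scubes I C (Suc 0)"
  shows "degenerate I C (Suc 0) x \<Longrightarrow> cell_dim C (x (Rcl {[0]})) = 0"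
    "\<not> degenerate I C (Suc 0) x \<Longrightarrow> cell_dim C (x (Rcl {[0]})) = 1"
proof -
  let ?c = "x (Rcl {[0]})"
  show "cell_dim C ?c = 0" if d: "degenerate I C (Suc 0) x"
  proof -
    obtain z where z: "z \<in> scubes I C 0" "x = cdegen I C 0 (Suc 0) z"
      using d unfolding degenerate_Suc by auto
    have eq: "x (Rcl {[k]}) = z (Rcl {[]})" if "k \<in> {-1, 0, 1}" for k
      using cdegen(2)[OF z(1), of 0 "[k]"] that unfolding z(2) by simp
    have "x (Rcl {[letter \<alpha>]}) = z (Rcl {[]})" "?c = z (Rcl {[]})" for \<alpha>
      by (rule eq; use letter_in[of \<alpha>] in simp)+
    then have "bd C \<alpha> 0 ?c = ?c" for \<alpha>
      using edge_value(1)[OF x, of \<alpha>] by simp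
    then show ?thesis unfolding cell_dim_def by (intro Least_eq_0) simp
  qed
  show "cell_dim C ?c = 1" if "\<not> degenerate I C (Suc 0) x"
    unfolding cell_dim_def
  proof (rule Least_equality)
    show "bd C Minus 1 ?c = ?c \<and> bd C Plus 1 ?c = ?c" using edge_value(2)[OF x] by simp
    fix p assume p: "bd C Minus p ?c = ?c \<and> bd C Plus p ?c = ?c"
    show "1 \<le> p"
    proof (rule ccontr)
      assume "\<not> 1 \<le> p"
      then have "p = 0" by simp
      \<comment> \<open>A cell of dimension 0 is its own source and target, so x takes one value on
        all three faces and is the degeneracy of a vertex.\<close>
      then have c: "x (Rcl {[letter \<alpha>]}) = ?c" for \<alpha>
        using p edge_value(1)[OF x, of \<alpha>] by (cases \<alpha>) auto
      let ?z = "cface I C Minus (Suc 0) (Suc 0) x"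
      have z: "?z \<in> scubes I C 0" using cface(1)[OF x] by simp
      have "x = cdegen I C 0 (Suc 0) ?z"
      proof (rule scube_eqI)
        fix k assume k: "k \<in> faces (Suc 0)"
        then obtain a where a: "k = [a]" "a \<in> {-1, 0, 1}" by (auto elim: faces_SucE simp: faces_0)
        have "cdegen I C 0 (Suc 0) ?z (Rcl {k}) = x (Rcl {[-1]})"
          using cdegen(2)[OF z, of 0 k] cface(2)[OF x, of 0 "[]" Minus] k a by simp
        then show "x (Rcl {k}) = cdegen I C 0 (Suc 0) ?z (Rcl {k})"
          using a c[of Minus] c[of Plus] by auto
      qed (use x z cdegen(1) in auto)
      then show False using that degenerate_cdegen[OF z, of 0] by simp
    qed
  qed
qed

section \<open>Functoriality\<close>

lemma corner_nerve_map_cube: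
  assumes f: "f \<in> omega_functors C D" and x: "x \<in> scubes I C (Suc n)"
  shows "corner_nerve_map I f n x \<in> scubes I D (Suc n)"
    "k \<in> faces (Suc n) \<Longrightarrow> corner_nerve_map I f n x (Rcl {k}) = f (x (Rcl {k}))"
proof -
  show "corner_nerve_map I f n x \<in> scubes I D (Suc n)"
    using omega_functors_compose[OF is_cubeD(1)[OF cubes] _ f] x
    by (simp add: corner_nerve_map_def scubes_def)
  show "corner_nerve_map I f n x (Rcl {k}) = f (x (Rcl {k}))" if "k \<in> faces (Suc n)"
    using cube_Rcl[OF that] by (simp add: corner_nerve_map_def compose_eq)
qed

context
  fixes C :: "'c ocat" and D :: "'d ocat" and f :: "'c \<Rightarrow> 'd"
  assumes f: "f \<in> omega_functors C D"
begin

lemmas map_cube = corner_nerve_map_cube[OF f]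

lemma corner_nerve_map_cface:
  assumes "x \<in> scubes I C (Suc (Suc n))" "i \<le> Suc n"
  shows "corner_nerve_map I f n (cface I C \<alpha> (Suc (Suc n)) (Suc i) x) =
    cface I D \<alpha> (Suc (Suc n)) (Suc i) (corner_nerve_map I f (Suc n) x)"
  using assms
  by (intro scube_eqI[of _ D "Suc n"])
     (simp_all add: map_cube cface cface insert_faces)

lemma corner_nerve_map_connection:
  assumes "x \<in> scubes I C (Suc n)" "i \<le> n"
  shows "corner_nerve_map I f (Suc n) (connection I C \<alpha> (Suc n) (Suc i) x) =
    connection I D \<alpha> (Suc n) (Suc i) (corner_nerve_map I f n x)"
  using assms
  by (intro scube_eqI[of _ D "Suc (Suc n)"])
     (simp_all add: map_cube connection connection merge_faces)

text \<open>Iterating faces in all directions but the degenerate one leads to a degenerate edge, and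
  the edges of a corner cube are \<open>1\<close>-dimensional, so stay so under \<open>f\<close>.\<close>

lemma corner_nerve_map_not_degenerate:
  assumes nc: "non_1_contracting C D f"
  shows "x \<in> corner_cubes I C \<alpha> (Suc n) \<Longrightarrow> \<not> degenerate I D (Suc n) (corner_nerve_map I f n x)"
proof (induction n arbitrary: x)
  case 0
  then have x: "x \<in> scubes I C (Suc 0)" "\<not> degenerate I C (Suc 0) x"
    using corner_cubes_Suc by blast+
  have "x (Rcl {[0]}) \<in> cells C"
    using x(1) cube_Rcl[of "[0]" "Suc 0"] omega_functorsD(2) by (auto simp: scubes_def)
  then have "cell_dim D (f (x (Rcl {[0]}))) = 1"
    using nc edge_dim(2)[OF x] by (simp add: non_1_contracting_def)
  then show ?case using edge_dim(1)[OF map_cube(1)[OF x(1)]] map_cube(2)[OF x(1), of "[0]"] by auto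
next
  case (Suc n)
  have x: "x \<in> scubes I C (Suc (Suc n))"
    "\<And>i. i \<le> Suc n \<Longrightarrow> cface I C \<alpha> (Suc (Suc n)) (Suc i) x \<in> corner_cubes I C \<alpha> (Suc n)"
    using Suc.prems corner_cubes_Suc by blast+
  show ?case
  proof
    assume d: "degenerate I D (Suc (Suc n)) (corner_nerve_map I f (Suc n) x)"
    then obtain j z where z: "j \<le> Suc n" "z \<in> scubes I D (Suc n)"
      "corner_nerve_map I f (Suc n) x = cdegen I D (Suc n) (Suc j) z"
      using degenerate_Suc by blast
    \<comment> \<open>Some direction other than that of the degeneracy; it exists because the cube
      has dimension at least two.\<close>
    define i where "i = (if j = 0 then 1 else 0 :: nat)"
    have i: "i \<le> Suc n" by (simp add: i_def)
    have "degenerate I D (Suc n) (cface I D \<alpha> (Suc (Suc n)) (Suc i) (cdegen I D (Suc n) (Suc j) z))"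
    proof (cases j)
      case 0
      then show ?thesis
        using cface_cdegen_greater[OF z(2), of 0 0 \<alpha>] cface(1)[OF z(2), of 0 \<alpha>]
        by (simp add: i_def degenerate_cdegen)
    next
      case (Suc j')
      then show ?thesis
        using cface_cdegen_less[OF z(2), of 0 j' \<alpha>] cface(1)[OF z(2), of 0 \<alpha>] z(1)
        by (simp add: i_def degenerate_cdegen)
    qed
    then have "degenerate I D (Suc n) (corner_nerve_map I f n (cface I C \<alpha> (Suc (Suc n)) (Suc i) x))"
      using corner_nerve_map_cface[OF x(1) i, of \<alpha>] z(3) by simp
    then show False using Suc.IH[OF x(2)[OF i]] by simp
  qed
qed

lemma corner_nerve_map_corner:
  assumes nc: "non_1_contracting C D f"
  shows "x \<in> corner_cubes I C \<alpha> (Suc n) \<Longrightarrow> corner_nerve_map I f n x \<in> corner_cubes I D \<alpha> (Suc n)"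
proof (induction n arbitrary: x)
  case 0
  have m: "corner_nerve_map I f 0 x \<in> scubes I D (Suc 0)"
    by (rule map_cube(1)) (use 0 in \<open>simp add: corner_cubes_def\<close>)
  then show ?case
    using corner_nerve_map_not_degenerate[OF nc 0] cface(1)[OF m, of 0 \<alpha>]
    unfolding corner_cubes_Suc corner_cubes_0 by simp
next
  case (Suc n)
  have x: "x \<in> scubes I C (Suc (Suc n))"
    "\<And>i. i \<le> Suc n \<Longrightarrow> cface I C \<alpha> (Suc (Suc n)) (Suc i) x \<in> corner_cubes I C \<alpha> (Suc n)"
    using Suc.prems corner_cubes_Suc by blast+
  have "cface I D \<alpha> (Suc (Suc n)) (Suc i) (corner_nerve_map I f (Suc n) x) \<in> corner_cubes I D \<alpha> (Suc n)"
    if "i \<le> Suc n" for i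
    using Suc.IH[OF x(2)[OF that]] corner_nerve_map_cface[OF x(1) that, of \<alpha>] by simp
  then show ?case
    using map_cube(1)[OF x(1)] corner_nerve_map_not_degenerate[OF nc Suc.prems]
    unfolding corner_cubes_Suc[of _ _ _ "Suc n"] by blast
qed

lemma corner_nerve_map_simplicial:
  assumes nc: "non_1_contracting C D f"
  shows "simplicial_map (corner_nerve I C \<alpha>) (corner_nerve I D \<alpha>) (corner_nerve_map I f)"
  using corner_nerve_map_corner[OF nc] corner_nerve_map_cface[OF corner_cubes_scubes]
    corner_nerve_map_connection[OF corner_cubes_scubes]
  by (simp add: simplicial_map_def corner_nerve_def)

end

end

section \<open>Comparison of the chain complexes\<close>

lemma unnormalized_boundary_corner_nerve:
  "unnormalized_boundary (corner_nerve I C \<alpha>) n = corner_boundary I C \<alpha> (Suc n)"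
  unfolding unnormalized_boundary_def corner_boundary_def
  \<comment> \<open>Shifting the index turns the sign of exponent i + 1 into one of exponent i + 2,
    so no correction of signs arises.\<close>
  using sum.shift_bounds_cl_Suc_ivl[of "\<lambda>i. frag_cmul ((-1) ^ (i + 1)) (frag_of (cface I C \<alpha> (Suc n) i x))" 0 n for x]
  by (simp add: corner_nerve_def)

text \<open>The restriction to positive n comes from the cycles: in degree 0 every chain of the
  nerve is a cycle, while degree 1 of the corner complex still has a boundary map to
  vertices.\<close>

lemma corner_nerve_homology:
  assumes "n \<ge> 1"
  shows "unnormalized_homology (corner_nerve I C \<alpha>) n = corner_homology I C \<alpha> (n + 1)"
proof -
  obtain m where "n = Suc m" using assms by (cases n) auto
  then show ?thesis
    unfolding unnormalized_homology_def corner_homology_def chain_homology_def cycles_def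
      unnormalized_boundary_corner_nerve
    by (simp add: corner_nerve_def)
qed

theorem proposition6p2:
  fixes I :: cubes
    and C :: "'c ocat" and D :: "'d ocat" and E :: "'e ocat"
    and \<alpha> :: sign
  assumes cube: "\<And>n. is_cube n (I n)"
    and C: "omega_category C" and D: "omega_category D" and E: "omega_category E"
  shows "simplicial_set (corner_nerve I C \<alpha>) \<and>
    (\<forall>n\<ge>1. unnormalized_homology (corner_nerve I C \<alpha>) n \<cong> corner_homology I C \<alpha> (n + 1)) \<and>
    (\<forall>f \<in> omega_cat1_hom C D.
       simplicial_map (corner_nerve I C \<alpha>) (corner_nerve I D \<alpha>) (corner_nerve_map I f)) \<and>
    (\<forall>n. \<forall>x \<in> simplices (corner_nerve I C \<alpha>) n.
       corner_nerve_map I (\<lambda>c \<in> cells C. c) n x = x) \<and>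
    (\<forall>f \<in> omega_cat1_hom C D. \<forall>g \<in> omega_cat1_hom D E.
       \<forall>n. \<forall>x \<in> simplices (corner_nerve I C \<alpha>) n.
         corner_nerve_map I (compose (cells C) g f) n x =
           corner_nerve_map I g n (corner_nerve_map I f n x))"
proof (intro conjI ballI allI impI)
  interpret cubical_nerve I by standard (rule cube)
  have simplex: "x \<in> omega_functors (I (Suc n)) C" if "x \<in> simplices (corner_nerve I C \<alpha>) n" for x n
    using that corner_cubes_scubes by (simp add: corner_nerve_def scubes_def)
  show "simplicial_set (corner_nerve I C \<alpha>)" by (rule corner_nerve_simplicial)
  show "unnormalized_homology (corner_nerve I C \<alpha>) n \<cong> corner_homology I C \<alpha> (n + 1)" if "n \<ge> 1" for n
    unfolding corner_nerve_homology[OF that] by (rule iso_refl)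
  show "simplicial_map (corner_nerve I C \<alpha>) (corner_nerve I D \<alpha>) (corner_nerve_map I f)"
    if "f \<in> omega_cat1_hom C D" for f
    by (rule corner_nerve_map_simplicial) (use that in \<open>simp_all add: omega_cat1_hom_def\<close>)
  show "corner_nerve_map I (\<lambda>c \<in> cells C. c) n x = x"
    if x: "x \<in> simplices (corner_nerve I C \<alpha>) n" for n x
  \<comment> \<open>The identity of C is extensional as well: it fixes the values of x because they
    are cells of C, and outside the cells of the cube both sides are undefined.\<close>
  proof (rule extensionalityI[of _ "cells (I (Suc n))"])
    show "x \<in> extensional (cells (I (Suc n)))"
      using omega_functorsD(1)[OF simplex[OF x]] .
    show "corner_nerve_map I (\<lambda>c \<in> cells C. c) n x S = x S" if "S \<in> cells (I (Suc n))" for S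
      using that omega_functorsD(2)[OF simplex[OF x] that]
      by (simp add: corner_nerve_map_def compose_eq)
  qed (simp add: corner_nerve_map_def compose_extensional)
  show "corner_nerve_map I (compose (cells C) g f) n x =
      corner_nerve_map I g n (corner_nerve_map I f n x)"
    if x: "x \<in> simplices (corner_nerve I C \<alpha>) n" for f g n x
  proof -
    have "compose (cells C) g f (x S) = g (f (x S))" if "S \<in> cells (I (Suc n))" for S
      using omega_functorsD(2)[OF simplex[OF x] that] by (simp add: compose_eq)
    then show ?thesis by (auto simp: corner_nerve_map_def compose_def)
  qed
qed

end
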